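(* (Amortization collapse.) Let $N,K\ge 1$ be integers and let $\mathcal{E}$ and $\mathcal{F}$ be arbitrary quantum operations (completely positive trace-preserving maps) acting on $\mathcal{M}_N$. Then $$d_{\mathrm{t}}^{A}(\mathcal{E},\mathcal{F})=d_{\mathrm{t}}^{K}(\mathcal{E},\mathcal{F}),$$ where $d_{\mathrm{t}}^{A}$ is the amortized entropic divergence with ancilla of dimension $K$ and $d_{\mathrm{t}}^{K}$ is the entropic channel divergence with ancilla of dimension $K$.
   Context: $\mathcal{M}_n$ denotes the set of density matrices (positive semidefinite, trace one) on an $n$-dimensional complex Hilbert space; $\mathcal{M}_{NK}$ is the set of density matrices on $\mathbb{C}^N\otimes\mathbb{C}^K$. $\mathbb{1}_K$ denotes the identity map on operators on $\mathbb{C}^K$. The von Neumann entropy is $\mathrm{S}(\rho)=-\mathrm{Tr}[\rho\log_2\rho]$ (with $0\log_2 0=0$). The quantum Jensen-Shannon divergence is $\mathrm{QJSD}(\rho,\sigma)=\mathrm{S}\big(\tfrac{\rho+\sigma}{2}\big)-\tfrac12\mathrm{S}(\rho)-\tfrac12\mathrm{S}(\sigma)$, and the transmission distance between states is $d_{\mathrm{t}}(\rho,\sigma)=\sqrt{\mathrm{QJSD}(\rho,\sigma)}$. For quantum operations $\mathcal{E},\mathcal{F}$ on $\mathcal{M}_N$ (extended linearly to all $N\times N$ matrices), the entropic channel divergence with ancilla of dimension $K$ is $$d_{\mathrm{t}}^{K}(\mathcal{E},\mathcal{F})=\sup_{\sigma\in\mathcal{M}_{NK}} d_{\mathrm{t}}[(\mathcal{E}\otimes\mathbb{1}_K)(\sigma),(\mathcal{F}\otimes\mathbb{1}_K)(\sigma)],$$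 and the amortized entropic divergence (which depends on $K$) is $$d_{\mathrm{t}}^{A}(\mathcal{E},\mathcal{F})=\sup_{\rho,\sigma\in\mathcal{M}_{NK}}\Big\{d_{\mathrm{t}}[(\mathcal{E}\otimes\mathbb{1}_K)(\rho),(\mathcal{F}\otimes\mathbb{1}_K)(\sigma)]-d_{\mathrm{t}}(\rho,\sigma)\Big\}.$$ *)

theory Defs
  imports Complex_Main "Jordan_Normal_Form.Schur_Decomposition"
begin

definition mat_trace :: "complex mat \<Rightarrow> complex" where
  "mat_trace A = (\<Sum>i<dim_row A. A $$ (i, i))"

text \<open>The order on complex numbers is that of HOL-Library.Complex_Order: 0 \<le> z says that z is
  real and nonnegative. Over the complex numbers, this condition makes A Hermitian.\<close>

definition psd_mat :: "nat \<Rightarrow> complex mat \<Rightarrow> bool" where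
  "psd_mat n A \<longleftrightarrow> A \<in> carrier_mat n n \<and> (\<forall>v\<in>carrier_vec n. 0 \<le> (A *\<^sub>v v) \<bullet>c v)"

definition density_mats :: "nat \<Rightarrow> complex mat set" where
  "density_mats n = {\<rho>. psd_mat n \<rho> \<and> mat_trace \<rho> = 1}"


subsection \<open>Functional calculus and von Neumann entropy\<close>

definition unitary_mat :: "nat \<Rightarrow> complex mat \<Rightarrow> bool" where
  "unitary_mat n U \<longleftrightarrow> U \<in> carrier_mat n n \<and>
     mat_adjoint U * U = 1\<^sub>m n \<and> U * mat_adjoint U = 1\<^sub>m n"

definition spectral_form :: "nat \<Rightarrow> complex mat \<Rightarrow> (nat \<Rightarrow> real) \<Rightarrow> complex mat" where
  "spectral_form n U d = U * mat_diag n (\<lambda>i. complex_of_real (d i)) * mat_adjoint U"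

text \<open>The value f(A) for Hermitian A and real f; it does not depend on the chosen diagonalization,
  see \<open>mat_fun_eq\<close> below.\<close>

definition mat_fun :: "(real \<Rightarrow> real) \<Rightarrow> complex mat \<Rightarrow> complex mat" where
  "mat_fun f A = (THE B. \<exists>U d. unitary_mat (dim_row A) U \<and>
     A = spectral_form (dim_row A) U d \<and> B = spectral_form (dim_row A) U (\<lambda>i. f (d i)))"

lemma mat_adjoint_carrier: "A \<in> carrier_mat n m \<Longrightarrow> mat_adjoint A \<in> carrier_mat m n"
  by (rule carrier_matI) (simp_all add: mat_adjoint_def mat_of_rows_carrier)

lemma spectral_form_unique:
  assumes U: "unitary_mat n U" and V: "unitary_mat n V"
    and eq: "spectral_form n U d = spectral_form n V e"
  shows "spectral_form n U (\<lambda>i. f (d i)) = spectral_form n V (\<lambda>i. f (e i))"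
proof -
  define U' V' where "U' = mat_adjoint U" and "V' = mat_adjoint V"
  define W where "W = V' * U"
  let ?D = "\<lambda>d. mat_diag n (\<lambda>i. complex_of_real (d i))"
  have c: "U \<in> carrier_mat n n" "V \<in> carrier_mat n n"
      "U' \<in> carrier_mat n n" "V' \<in> carrier_mat n n" "\<And>d. ?D d \<in> carrier_mat n n"
    using U V by (auto simp: unitary_mat_def U'_def V'_def mat_adjoint_carrier)
  have cW: "W \<in> carrier_mat n n" using c by (auto simp: W_def)
  have u: "U' * U = 1\<^sub>m n" "V' * V = 1\<^sub>m n" "U * U' = 1\<^sub>m n" "V * V' = 1\<^sub>m n"
    using U V by (auto simp: unitary_mat_def U'_def V'_def)
  note as = assoc_mult_mat[of _ n n _ n _ n]
  have conv: "U * A * U' = V * B * V' \<longleftrightarrow> W * A = B * W"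
    if A: "A \<in> carrier_mat n n" and B: "B \<in> carrier_mat n n" for A B
  proof
    assume h: "U * A * U' = V * B * V'"
    have "W * A = V' * (U * A * U') * U"
      using c A u by (simp add: W_def as)
    also have "\<dots> = (V' * V) * B * (V' * U)"
      unfolding h using c B by (simp add: as)
    finally show "W * A = B * W" using c B u by (simp add: W_def)
  next
    assume h: "W * A = B * W"
    have "U * A * U' = (V * V') * U * A * U'" using c A u by simp
    also have "\<dots> = V * (W * A) * U'" using c A by (simp add: W_def as)
    also have "\<dots> = V * B * V' * (U * U')" unfolding h using c B by (simp add: W_def as)
    finally show "U * A * U' = V * B * V'" using c B u by simp
  qed
  have "W * ?D d = ?D e * W"
    using eq conv[of "?D d" "?D e"] c by (simp add: spectral_form_def U'_def V'_def)
  then have "mat n n (\<lambda>(i,j). W $$ (i,j) * d j) = mat n n (\<lambda>(i,j). e i * W $$ (i,j))"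
    unfolding mat_diag_mult_right[OF cW] mat_diag_mult_left[OF cW] .
  then have h: "W $$ (i,j) * d j = e i * W $$ (i,j)" if "i < n" "j < n" for i j
    using that by (auto dest!: arg_cong[where f="\<lambda>M. M $$ (i,j)"])
  have "W $$ (i,j) * f (d j) = f (e i) * W $$ (i,j)" if "i < n" "j < n" for i j
    using h[OF that] by (cases "W $$ (i,j) = 0") (auto simp: mult.commute)
  then have "W * ?D (\<lambda>i. f (d i)) = ?D (\<lambda>i. f (e i)) * W"
    unfolding mat_diag_mult_right[OF cW] mat_diag_mult_left[OF cW] by (intro cong_mat) auto
  then show ?thesis
    using conv[of "?D (\<lambda>i. f (d i))" "?D (\<lambda>i. f (e i))"] c
    by (simp add: spectral_form_def U'_def V'_def)
qed

lemma mat_fun_eq: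
  assumes U: "unitary_mat n U"
  shows "mat_fun f (spectral_form n U d) = spectral_form n U (\<lambda>i. f (d i))"
proof -
  have dim: "dim_row (spectral_form n U d) = n"
    using U by (auto simp: spectral_form_def unitary_mat_def)
  show ?thesis
    unfolding mat_fun_def dim
  proof (rule the_equality)
    show "\<exists>V e. unitary_mat n V \<and> spectral_form n U d = spectral_form n V e \<and>
        spectral_form n U (\<lambda>i. f (d i)) = spectral_form n V (\<lambda>i. f (e i))"
      by (intro exI[of _ U] exI[of _ d]) (simp add: U)
  next
    fix B
    assume "\<exists>V e. unitary_mat n V \<and> spectral_form n U d = spectral_form n V e \<and>
        B = spectral_form n V (\<lambda>i. f (e i))"
    then obtain V e where V: "unitary_mat n V"
      and eq: "spectral_form n U d = spectral_form n V e"
      and B: "B = spectral_form n V (\<lambda>i. f (e i))" by blast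
    show "B = spectral_form n U (\<lambda>i. f (d i))"
      unfolding B by (rule spectral_form_unique[OF V U eq[symmetric], of f])
  qed
qed

text \<open>Since \<open>log 2 0 = 0\<close> in the library, the convention 0 log 0 = 0 holds.\<close>

definition vn_entropy :: "complex mat \<Rightarrow> real" where
  "vn_entropy \<rho> = - Re (mat_trace (\<rho> * mat_fun (log 2) \<rho>))"

definition qjsd :: "complex mat \<Rightarrow> complex mat \<Rightarrow> real" where
  "qjsd \<rho> \<sigma> = vn_entropy ((1/2) \<cdot>\<^sub>m (\<rho> + \<sigma>)) - vn_entropy \<rho> / 2 - vn_entropy \<sigma> / 2"

definition transmission_dist :: "complex mat \<Rightarrow> complex mat \<Rightarrow> real" where
  "transmission_dist \<rho> \<sigma> = sqrt (qjsd \<rho> \<sigma>)"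


subsection \<open>Quantum operations and their ancilla extensions\<close>

text \<open>Basis vector number i * K + a of the NK-dimensional space stands for the tensor product of
  the basis vectors number i (system, i < N) and a (ancilla, a < K).\<close>

definition kron :: "complex mat \<Rightarrow> complex mat \<Rightarrow> complex mat" where
  "kron A B = mat (dim_row A * dim_row B) (dim_col A * dim_col B)
     (\<lambda>(r, c). A $$ (r div dim_row B, c div dim_col B) * B $$ (r mod dim_row B, c mod dim_col B))"

definition ancilla_block :: "nat \<Rightarrow> nat \<Rightarrow> complex mat \<Rightarrow> nat \<Rightarrow> nat \<Rightarrow> complex mat" where
  "ancilla_block N K X a b = mat N N (\<lambda>(i, j). X $$ (i * K + a, j * K + b))"

text \<open>The map \<open>\<E> \<otimes> 1\<close>: every X is the sum over a, b < K of \<open>kron\<close> of its block (a, b) with the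
  matrix unit (a, b), and \<open>\<E>\<close> acts on the blocks. By the three lemmas below, this is the linear map
  that takes \<open>kron A B\<close> to \<open>kron (\<E> A) B\<close>.\<close>

definition tensor_id ::
  "nat \<Rightarrow> nat \<Rightarrow> (complex mat \<Rightarrow> complex mat) \<Rightarrow> complex mat \<Rightarrow> complex mat" where
  "tensor_id N K \<E> X = mat (N * K) (N * K)
     (\<lambda>(r, c). \<E> (ancilla_block N K X (r mod K) (c mod K)) $$ (r div K, c div K))"

definition linear_mat_map :: "nat \<Rightarrow> (complex mat \<Rightarrow> complex mat) \<Rightarrow> bool" where
  "linear_mat_map N \<E> \<longleftrightarrow>
     (\<forall>A\<in>carrier_mat N N. \<E> A \<in> carrier_mat N N) \<and>
     (\<forall>A\<in>carrier_mat N N. \<forall>B\<in>carrier_mat N N. \<E> (A + B) = \<E> A + \<E> B) \<and>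
     (\<forall>c. \<forall>A\<in>carrier_mat N N. \<E> (c \<cdot>\<^sub>m A) = c \<cdot>\<^sub>m \<E> A)"

definition completely_positive :: "nat \<Rightarrow> (complex mat \<Rightarrow> complex mat) \<Rightarrow> bool" where
  "completely_positive N \<E> \<longleftrightarrow>
     (\<forall>k X. psd_mat (N * k) X \<longrightarrow> psd_mat (N * k) (tensor_id N k \<E> X))"

definition trace_preserving :: "nat \<Rightarrow> (complex mat \<Rightarrow> complex mat) \<Rightarrow> bool" where
  "trace_preserving N \<E> \<longleftrightarrow> (\<forall>A\<in>carrier_mat N N. mat_trace (\<E> A) = mat_trace A)"

definition quantum_operation :: "nat \<Rightarrow> (complex mat \<Rightarrow> complex mat) \<Rightarrow> bool" where
  "quantum_operation N \<E> \<longleftrightarrow>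
     linear_mat_map N \<E> \<and> completely_positive N \<E> \<and> trace_preserving N \<E>"

lemma nat_pair_index_less:
  fixes K :: nat
  assumes "i < N" "a < K"
  shows "i * K + a < N * K"
proof -
  have "i * K + a < Suc i * K" using assms by simp
  also have "\<dots> \<le> N * K" using assms by (intro mult_le_mono1) simp
  finally show ?thesis .
qed

lemma div_mod_index_less:
  fixes r :: nat
  assumes "r < N * K"
  shows "r div K < N" "r mod K < K"
proof -
  show "r div K < N" using assms by (rule less_mult_imp_div_less)
  show "r mod K < K" using assms by (cases "K = 0") simp_all
qed

lemma tensor_id_kron:
  assumes "linear_mat_map N \<E>" and A: "A \<in> carrier_mat N N" and B: "B \<in> carrier_mat K K"
  shows "tensor_id N K \<E> (kron A B) = kron (\<E> A) B"
proof -
  have EA: "\<E> A \<in> carrier_mat N N" and sm: "\<And>c. \<E> (c \<cdot>\<^sub>m A) = c \<cdot>\<^sub>m \<E> A"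
    using assms by (auto simp: linear_mat_map_def)
  have blk: "ancilla_block N K (kron A B) a b = B $$ (a, b) \<cdot>\<^sub>m A" if "a < K" "b < K" for a b
    using that A B by (intro eq_matI) (auto simp: ancilla_block_def kron_def nat_pair_index_less)
  have dims: "dim_row A = N" "dim_col A = N" "dim_row B = K" "dim_col B = K"
    "dim_row (\<E> A) = N" "dim_col (\<E> A) = N"
    using A B EA by auto
  show ?thesis
  proof (rule eq_matI)
    fix r c assume "r < dim_row (kron (\<E> A) B)" "c < dim_col (kron (\<E> A) B)"
    then have rc: "r < N * K" "c < N * K" by (simp_all add: kron_def dims)
    note less = div_mod_index_less[OF rc(1)] div_mod_index_less[OF rc(2)]
    have "tensor_id N K \<E> (kron A B) $$ (r, c)
        = (B $$ (r mod K, c mod K) \<cdot>\<^sub>m \<E> A) $$ (r div K, c div K)"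
      using rc by (simp add: tensor_id_def blk[OF less(2) less(4)] sm)
    also have "\<dots> = kron (\<E> A) B $$ (r, c)"
      using rc less by (simp add: kron_def dims)
    finally show "tensor_id N K \<E> (kron A B) $$ (r, c) = kron (\<E> A) B $$ (r, c)" .
  qed (simp_all add: tensor_id_def kron_def dims)
qed

lemma tensor_id_add:
  assumes "linear_mat_map N \<E>"
    and X: "X \<in> carrier_mat (N * K) (N * K)" and Y: "Y \<in> carrier_mat (N * K) (N * K)"
  shows "tensor_id N K \<E> (X + Y) = tensor_id N K \<E> X + tensor_id N K \<E> Y"
proof -
  have c: "ancilla_block N K X a b \<in> carrier_mat N N" for X a b
    by (simp add: ancilla_block_def)
  have blk: "ancilla_block N K (X + Y) a b = ancilla_block N K X a b + ancilla_block N K Y a b"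
    if "a < K" "b < K" for a b
    using that X Y by (intro eq_matI) (auto simp: ancilla_block_def nat_pair_index_less)
  have E: "\<E> (ancilla_block N K X a b) \<in> carrier_mat N N"
    "\<E> (ancilla_block N K X a b + ancilla_block N K Y a b) =
      \<E> (ancilla_block N K X a b) + \<E> (ancilla_block N K Y a b)" for X Y a b
    using assms(1) c by (auto simp: linear_mat_map_def)
  have d: "dim_row (\<E> (ancilla_block N K X a b)) = N"
    "dim_col (\<E> (ancilla_block N K X a b)) = N" for X a b
    using E(1)[of X a b] by auto
  show ?thesis
    by (rule eq_matI) (auto simp: tensor_id_def blk E(2) d div_mod_index_less)
qed

lemma tensor_id_smult:
  assumes "linear_mat_map N \<E>" and X: "X \<in> carrier_mat (N * K) (N * K)"
  shows "tensor_id N K \<E> (z \<cdot>\<^sub>m X) = z \<cdot>\<^sub>m tensor_id N K \<E> X"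
proof -
  have c: "ancilla_block N K X a b \<in> carrier_mat N N" for a b
    by (simp add: ancilla_block_def)
  have blk: "ancilla_block N K (z \<cdot>\<^sub>m X) a b = z \<cdot>\<^sub>m ancilla_block N K X a b"
    if "a < K" "b < K" for a b
    using that X by (intro eq_matI) (auto simp: ancilla_block_def nat_pair_index_less)
  have E: "\<E> (ancilla_block N K X a b) \<in> carrier_mat N N"
    "\<E> (z \<cdot>\<^sub>m ancilla_block N K X a b) = z \<cdot>\<^sub>m \<E> (ancilla_block N K X a b)" for a b
    using assms(1) c by (auto simp: linear_mat_map_def)
  have d: "dim_row (\<E> (ancilla_block N K X a b)) = N"
    "dim_col (\<E> (ancilla_block N K X a b)) = N" for a b
    using E(1)[of a b] by auto
  show ?thesis
    by (rule eq_matI) (auto simp: tensor_id_def blk E(2) d div_mod_index_less)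
qed


subsection \<open>Channel divergences\<close>

text \<open>The suprema are real ones: for N, K > 0 and quantum operations they range over nonempty sets
  that are bounded above, as the transmission distance of density matrices lies in [0, 1].\<close>

definition channel_divergence ::
  "nat \<Rightarrow> nat \<Rightarrow> (complex mat \<Rightarrow> complex mat) \<Rightarrow> (complex mat \<Rightarrow> complex mat) \<Rightarrow> real" where
  "channel_divergence N K \<E> \<F> =
     (SUP \<sigma>\<in>density_mats (N * K).
        transmission_dist (tensor_id N K \<E> \<sigma>) (tensor_id N K \<F> \<sigma>))"

definition amortized_divergence ::
  "nat \<Rightarrow> nat \<Rightarrow> (complex mat \<Rightarrow> complex mat) \<Rightarrow> (complex mat \<Rightarrow> complex mat) \<Rightarrow> real" where
  "amortized_divergence N K \<E> \<F> =
     (SUP (\<rho>, \<sigma>)\<in>density_mats (N * K) \<times> density_mats (N * K).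
        transmission_dist (tensor_id N K \<E> \<rho>) (tensor_id N K \<F> \<sigma>) - transmission_dist \<rho> \<sigma>)"

end

(* The transmission distance is a metric on density matrices that contracts under quantum operations,
   and E tensor 1 is again a quantum operation.  Hence
     d(E rho, F sigma) <= d(E rho, E sigma) + d(E sigma, F sigma) <= d(rho, sigma) + d(E sigma, F sigma),
   and rho = sigma recovers the unamortized supremum.

   Triangle inequality (after Sra).  Up to the factor ln 2, the derivative in t of QJSD(A + t, B + t) is
   minus the gap ln det((A+B)/2) - (ln det A + ln det B)/2 at (A + t, B + t), and QJSD(A + t, B + t)
   tends to 0 as t grows.  All triangle inequalities are used in the form
   a <= (1 + s) b + (1 + 1/s) c for every s > 0, which is linear in the squared distances and therefore
   passes from the gap to QJSD.  The gap is invariant under congruence, so one of the matrices may be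
   taken to be 1; Jensen's inequality in an eigenbasis of (A+B)/2 then bounds the gap from below by a
   doubly stochastic average of scalar gaps ln cosh((ln a - ln b)/2), and sqrt(ln cosh) is subadditive.

   Data processing.  QJSD is the mean of two relative entropies, and D(rho, sigma) is the integral over
   u in [0, 1] of (1 - u) times the quadratic form of rho - sigma at the inverse of the superoperator
   X -> (1 - u) sigma X + u X rho.  That form is a supremum over test matrices X, and a test matrix for
   the output is pulled back to one for the input by the dual map, at no loss by the Schwarz inequality. *)

theory Submission
  imports Defs "Jordan_Normal_Form.Spectral_Radius"
begin

section \<open>Adjoints, positive semidefinite matrices and the spectral theorem\<close>

text \<open>The obstacle is non-commutativity, and both halves reach scalars before any calculus
  starts. Along A + t the eigenvectors stay fixed, so every entropy is a sum of scalar functions of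
  t and no matrix function has to be differentiated. Left multiplication by \<open>\<sigma>\<close>
  commutes with right multiplication by \<open>\<rho>\<close>, so the superoperator is diagonal in
  the pair of eigenbases and the integral over u has an explicit antiderivative, entry by entry. The
  weights come from a minimum: for b, c > 0 the least value of (1 + s) b + (1 + 1/s) c over s > 0 is
  the square of sqrt b + sqrt c, attained at s = sqrt (c / b). The family in s therefore says the
  same as the triangle inequality for the square roots. Density matrices may be singular. In the
  triangle inequality t = 0 is therefore reached only as a limit; in data processing the second
  argument is always the mean, whose kernel lies in the kernels of both matrices, so the logarithms
  of 0 carry weight 0.\<close>

lemma dim_mat_adjoint [simp]:
  "dim_row (mat_adjoint A) = dim_col A" "dim_col (mat_adjoint A) = dim_row A"
  by (simp_all add: mat_adjoint_def)

lemma index_mat_adjoint [simp]: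
  fixes A :: "complex mat"
  assumes "i < dim_col A" "j < dim_row A"
  shows "mat_adjoint A $$ (i, j) = cnj (A $$ (j, i))"
  using assms by (simp add: mat_adjoint_def mat_of_rows_def conjugate_complex_def)

lemma mat_adjoint_adjoint [simp]: "mat_adjoint (mat_adjoint (A :: complex mat)) = A"
  by (rule eq_matI) simp_all

lemma mat_adjoint_mult:
  fixes A B :: "complex mat"
  assumes "A \<in> carrier_mat n m" "B \<in> carrier_mat m k"
  shows "mat_adjoint (A * B) = mat_adjoint B * mat_adjoint A"
  using assms by (intro eq_matI) (auto simp: scalar_prod_def intro!: sum.cong)

lemma mat_adjoint_one [simp]: "mat_adjoint (1\<^sub>m n :: complex mat) = 1\<^sub>m n"
  by (rule eq_matI) auto

lemma mat_adjoint_diag_real: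
  "mat_adjoint (mat_diag n (\<lambda>i. complex_of_real (d i))) = mat_diag n (\<lambda>i. complex_of_real (d i))"
  by (rule eq_matI) (auto simp: mat_diag_def)

lemma mat_trace_mult:
  assumes "A \<in> carrier_mat n m" "B \<in> carrier_mat m n"
  shows "mat_trace (A * B) = (\<Sum>i<n. \<Sum>j<m. A $$ (i, j) * B $$ (j, i))"
  using assms by (auto simp: mat_trace_def scalar_prod_def atLeast0LessThan intro!: sum.cong)

lemma mat_trace_comm:
  assumes "A \<in> carrier_mat n m" "B \<in> carrier_mat m n"
  shows "mat_trace (A * B) = mat_trace (B * A)"
proof -
  have "mat_trace (A * B) = (\<Sum>j<m. \<Sum>i<n. A $$ (i, j) * B $$ (j, i))"
    unfolding mat_trace_mult[OF assms] by (rule sum.swap)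
  then show ?thesis
    by (simp add: mat_trace_mult[OF assms(2,1)] mult.commute)
qed

lemma mat_trace_add:
  assumes "A \<in> carrier_mat n n" "B \<in> carrier_mat n n"
  shows "mat_trace (A + B) = mat_trace A + mat_trace B"
  using assms by (simp add: mat_trace_def sum.distrib)

lemma mat_trace_smult:
  assumes "A \<in> carrier_mat n n"
  shows "mat_trace (c \<cdot>\<^sub>m A) = c * mat_trace A"
  using assms by (auto simp: mat_trace_def sum_distrib_left intro!: sum.cong)

lemma mat_trace_adjoint:
  assumes "A \<in> carrier_mat n n"
  shows "mat_trace (mat_adjoint A) = cnj (mat_trace A)"
  using assms by (auto simp: mat_trace_def intro!: sum.cong)


section \<open>Positive semidefinite matrices: congruence, trace, Hermitian symmetry\<close>

lemma inner_mat_adjoint: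
  fixes A :: "complex mat"
  assumes A: "A \<in> carrier_mat n m" and v: "v \<in> carrier_vec m" and w: "w \<in> carrier_vec n"
  shows "(A *\<^sub>v v) \<bullet>c w = v \<bullet>c (mat_adjoint A *\<^sub>v w)"
proof -
  have "(A *\<^sub>v v) \<bullet>c w = (\<Sum>i<n. \<Sum>j<m. A $$ (i, j) * v $ j * cnj (w $ i))"
    using assms by (simp add: scalar_prod_def atLeast0LessThan sum_distrib_right conjugate_complex_def)
  also have "\<dots> = (\<Sum>j<m. \<Sum>i<n. A $$ (i, j) * v $ j * cnj (w $ i))"
    by (rule sum.swap)
  also have "\<dots> = v \<bullet>c (mat_adjoint A *\<^sub>v w)"
    using assms by (auto simp: scalar_prod_def atLeast0LessThan sum_distrib_left conjugate_complex_def
        ac_simps intro!: sum.cong)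
  finally show ?thesis .
qed

lemma psd_mat_congruence:
  assumes A: "psd_mat n A" and W: "W \<in> carrier_mat m n"
  shows "psd_mat m (W * A * mat_adjoint W)"
  unfolding psd_mat_def
proof (intro conjI ballI)
  have Ac: "A \<in> carrier_mat n n" using A by (simp add: psd_mat_def)
  show "W * A * mat_adjoint W \<in> carrier_mat m m"
    using W Ac by (auto simp: mat_adjoint_carrier)
  fix v :: "complex vec" assume v: "v \<in> carrier_vec m"
  have W': "mat_adjoint W \<in> carrier_mat n m" using W by (rule mat_adjoint_carrier)
  have "(W * A * mat_adjoint W) *\<^sub>v v = W *\<^sub>v (A *\<^sub>v (mat_adjoint W *\<^sub>v v))"
    using W W' Ac v by (simp add: assoc_mult_mat_vec[of _ m n _ m])
  then have "((W * A * mat_adjoint W) *\<^sub>v v) \<bullet>c v =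
      (A *\<^sub>v (mat_adjoint W *\<^sub>v v)) \<bullet>c (mat_adjoint W *\<^sub>v v)"
    using W W' Ac v by (simp add: inner_mat_adjoint[OF W])
  also have "0 \<le> \<dots>" using A W' v by (auto simp: psd_mat_def)
  finally show "0 \<le> ((W * A * mat_adjoint W) *\<^sub>v v) \<bullet>c v" .
qed

lemma psd_mat_diag_nonneg:
  assumes A: "psd_mat n A" and i: "i < n"
  shows "0 \<le> A $$ (i, i)"
proof -
  have Ac: "A \<in> carrier_mat n n" using A by (simp add: psd_mat_def)
  have "conjugate (unit_vec n i) = (unit_vec n i :: complex vec)"
    by (rule eq_vecI) (auto simp: unit_vec_def conjugate_complex_def)
  then have "(A *\<^sub>v unit_vec n i) \<bullet>c unit_vec n i = A $$ (i, i)"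
    using Ac i by (simp add: scalar_prod_right_unit[of _ n])
  then show ?thesis using A i by (auto simp: psd_mat_def dest!: bspec[of _ _ "unit_vec n i"])
qed

lemma psd_mat_trace_nonneg:
  assumes "psd_mat n A"
  shows "0 \<le> mat_trace A"
  using assms psd_mat_diag_nonneg[OF assms] by (auto simp: mat_trace_def psd_mat_def intro!: sum_nonneg)

lemma psd_mat_hermitian:
  assumes A: "psd_mat n A"
  shows "mat_adjoint A = A"
proof (rule eq_matI)
  have Ac: "A \<in> carrier_mat n n" using A by (simp add: psd_mat_def)
  show "dim_row (mat_adjoint A) = dim_row A" "dim_col (mat_adjoint A) = dim_col A"
    using Ac by auto
  fix i j assume "i < dim_row A" "j < dim_col A"
  then have ij: "i < n" "j < n" using Ac by auto
  \<comment> \<open>Polarization: this is the quadratic form at e_i + c e_j, read off as the single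
    entry of a congruence by a row. That it is real at c = 1 settles the imaginary parts, and at c =
    \<i> the real parts.\<close>
  have form: "0 \<le> (A $$ (i, i) + c * A $$ (i, j) + cnj c * A $$ (j, i) + c * cnj c * A $$ (j, j))" for c
  proof -
    define W where "W = mat 1 n (\<lambda>(a, b). (if b = i then 1 else 0) + (if b = j then cnj c else 0))"
    have W: "W \<in> carrier_mat 1 n" by (simp add: W_def)
    have "(W * A * mat_adjoint W) $$ (0, 0) = (\<Sum>l<n. \<Sum>k<n. W $$ (0, k) * A $$ (k, l) * cnj (W $$ (0, l)))"
      using W Ac by (simp add: scalar_prod_def atLeast0LessThan sum_distrib_right)
    also have "\<dots> = (\<Sum>l<n. (A $$ (i, l) + cnj c * A $$ (j, l)) * cnj (W $$ (0, l)))"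
    proof (rule sum.cong, simp)
      fix l assume "l \<in> {..<n}"
      have "(\<Sum>k<n. W $$ (0, k) * A $$ (k, l) * cnj (W $$ (0, l))) =
          (\<Sum>k<n. (if k = i then A $$ (k, l) * cnj (W $$ (0, l)) else 0) +
             (if k = j then cnj c * A $$ (k, l) * cnj (W $$ (0, l)) else 0))"
        by (rule sum.cong) (auto simp: W_def algebra_simps)
      also have "\<dots> = (A $$ (i, l) + cnj c * A $$ (j, l)) * cnj (W $$ (0, l))"
        using ij by (simp add: sum.distrib algebra_simps)
      finally show "(\<Sum>k<n. W $$ (0, k) * A $$ (k, l) * cnj (W $$ (0, l))) = \<dots>" .
    qed
    also have "\<dots> = (\<Sum>l<n. (if l = i then A $$ (i, l) + cnj c * A $$ (j, l) else 0) +
        (if l = j then c * (A $$ (i, l) + cnj c * A $$ (j, l)) else 0))"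
      by (rule sum.cong) (auto simp: W_def algebra_simps)
    also have "\<dots> = A $$ (i, i) + c * A $$ (i, j) + cnj c * A $$ (j, i) + c * cnj c * A $$ (j, j)"
      using ij by (simp add: sum.distrib algebra_simps)
    finally show ?thesis
      using psd_mat_diag_nonneg[OF psd_mat_congruence[OF A W], of 0] by simp
  qed
  have d: "Im (A $$ (i, i)) = 0" "Im (A $$ (j, j)) = 0"
    using psd_mat_diag_nonneg[OF A] ij by (auto simp: less_eq_complex_def)
  have "Im (A $$ (i, j)) + Im (A $$ (j, i)) = 0"
    using form[of 1] d by (simp add: less_eq_complex_def)
  moreover have "Re (A $$ (i, j)) - Re (A $$ (j, i)) = 0"
    using form[of \<i>] d by (simp add: less_eq_complex_def)
  ultimately have "cnj (A $$ (j, i)) = A $$ (i, j)"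
    by (simp add: complex_eq_iff)
  then show "mat_adjoint A $$ (i, j) = A $$ (i, j)"
    using ij Ac by simp
qed

section \<open>Unitary matrices and unitary diagonalization\<close>

lemma unitary_matI:
  assumes "U \<in> carrier_mat n n" "mat_adjoint U * U = 1\<^sub>m n"
  shows "unitary_mat n U"
  using assms mat_mult_left_right_inverse[OF mat_adjoint_carrier[OF assms(1)] assms(1)]
  by (simp add: unitary_mat_def)

lemma unitary_matD:
  assumes "unitary_mat n U"
  shows "U \<in> carrier_mat n n" "mat_adjoint U \<in> carrier_mat n n"
    "mat_adjoint U * U = 1\<^sub>m n" "U * mat_adjoint U = 1\<^sub>m n"
  using assms by (auto simp: unitary_mat_def mat_adjoint_carrier)

lemma unitary_mat_adjoint: "unitary_mat n U \<Longrightarrow> unitary_mat n (mat_adjoint U)"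
  by (auto simp: unitary_mat_def mat_adjoint_carrier)

lemma unitary_mat_mult:
  assumes "unitary_mat n U" "unitary_mat n V"
  shows "unitary_mat n (U * V)"
proof (rule unitary_matI)
  note u = unitary_matD[OF assms(1)] and v = unitary_matD[OF assms(2)]
  note as = assoc_mult_mat[of _ n n _ n _ n]
  show "U * V \<in> carrier_mat n n" using u v by simp
  have "mat_adjoint (U * V) * (U * V) = mat_adjoint V * (mat_adjoint U * U) * V"
    using u(1,2) v(1,2) by (simp add: mat_adjoint_mult[OF u(1) v(1)] as)
  then show "mat_adjoint (U * V) * (U * V) = 1\<^sub>m n" using u v by simp
qed

lemma unitary_mat_one: "unitary_mat n (1\<^sub>m n)"
  by (simp add: unitary_mat_def)

lemma spectral_form_carrier: "unitary_mat n U \<Longrightarrow> spectral_form n U d \<in> carrier_mat n n"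
  by (auto simp: spectral_form_def dest: unitary_matD intro!: mult_carrier_mat[of _ n n _ n])

text \<open>Gram-Schmidt on a basis that starts with v gives orthogonal columns of arbitrary length.
  Dividing each by its norm makes the matrix unitary and only rescales the first column, hence the
  factor c.\<close>

lemma exists_unitary_first_col:
  assumes v: "v \<in> carrier_vec n" and v0: "v \<noteq> 0\<^sub>v n"
  obtains U c where "unitary_mat n U" "col U 0 = c \<cdot>\<^sub>v (v :: complex vec)"
proof -
  interpret cof_vec_space n "TYPE(complex)" .
  define b where "b = basis_completion v"
  define ws where "ws = gram_schmidt n b"
  define W where "W = mat_of_cols n ws"
  from basis_completion[OF v v0, folded b_def]
  have dist_b: "distinct b" and indep: "\<not> lin_dep (set b)" and b: "set b \<subseteq> carrier_vec n"
    and hdb: "hd b = v" and len_b: "length b = n" by auto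
  have n: "n \<noteq> 0" using v v0 by auto
  from hdb len_b n obtain vs where bv: "b = v # vs" by (cases b) auto
  from gram_schmidt_result[OF b dist_b indep refl, folded ws_def]
  have ws: "set ws \<subseteq> carrier_vec n" "corthogonal ws" "length ws = n"
    by (auto simp: len_b)
  have hdws: "ws ! 0 = v"
    using gram_schmidt_hd[OF v, of vs, folded bv] ws(3) n hd_conv_nth[of ws]
    unfolding ws_def[symmetric] by auto
  have W: "W \<in> carrier_mat n n"
    using ws unfolding W_def using mat_of_cols_carrier(1)[of n ws] by auto
  define G where "G = mat_adjoint W * W"
  have G: "G \<in> carrier_mat n n" using W by (auto simp: G_def intro!: mult_carrier_mat[of _ n n _ n] mat_adjoint_carrier)
  have "corthogonal_mat W" using orthogonal_mat_of_cols ws unfolding W_def by blast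
  then have diag: "\<And>i j. i < n \<Longrightarrow> j < n \<Longrightarrow> i \<noteq> j \<Longrightarrow> G $$ (i, j) = 0"
    and nz: "\<And>i. i < n \<Longrightarrow> G $$ (i, i) \<noteq> 0"
    using G W by (auto simp: corthogonal_mat_def G_def[symmetric] diagonal_mat_def Let_def)
  define g where "g i = (\<Sum>k<n. (cmod (W $$ (k, i)))\<^sup>2)" for i
  have g: "G $$ (i, i) = complex_of_real (g i)" if "i < n" for i
    using that W by (auto simp: G_def g_def scalar_prod_def atLeast0LessThan mult.commute
        complex_norm_square simp del: of_real_power intro!: sum.cong)
  have gp: "g i > 0" if "i < n" for i
  proof -
    have "g i \<noteq> 0" using g[OF that] nz[OF that] by auto
    moreover have "g i \<ge> 0" unfolding g_def by (rule sum_nonneg) simp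
    ultimately show ?thesis by simp
  qed
  define D where "D = mat_diag n (\<lambda>i. complex_of_real (1 / sqrt (g i)))"
  have D: "D \<in> carrier_mat n n" "mat_adjoint D = D"
    using mat_adjoint_diag_real[of n "\<lambda>i. 1 / sqrt (g i)"] by (simp_all add: D_def)
  have "mat_adjoint (W * D) * (W * D) = D * (mat_adjoint W * (W * D))"
    using W D by (simp add: mat_adjoint_mult[OF W D(1)] mat_adjoint_carrier
        assoc_mult_mat[of _ n n _ n _ n])
  also have "\<dots> = D * (G * D)"
    using W D by (simp add: G_def mat_adjoint_carrier assoc_mult_mat[of _ n n _ n _ n, symmetric])
  also have "G * D = mat n n (\<lambda>(i, j). G $$ (i, j) * complex_of_real (1 / sqrt (g j)))"
    unfolding D_def by (rule mat_diag_mult_right[OF G])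
  also have "D * \<dots> = 1\<^sub>m n"
    unfolding D_def
  proof (subst mat_diag_mult_left[of _ n n], simp, rule eq_matI)
    fix i j assume ij: "i < dim_row (1\<^sub>m n)" "j < dim_col (1\<^sub>m n)"
    have "1 / sqrt (g i) * (g i * (1 / sqrt (g i))) = 1" if "i < n"
      using gp[OF that] real_sqrt_mult_self[of "g i"] by (simp add: field_simps)
    then have "complex_of_real (1 / sqrt (g i)) * (complex_of_real (g i) * complex_of_real (1 / sqrt (g i))) = 1"
      if "i < n" using that unfolding of_real_mult[symmetric] by (metis of_real_1)
    then show "mat n n (\<lambda>(i, j). complex_of_real (1 / sqrt (g i)) *
        mat n n (\<lambda>(i, j). G $$ (i, j) * complex_of_real (1 / sqrt (g j))) $$ (i, j)) $$ (i, j)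
        = 1\<^sub>m n $$ (i, j)"
      using ij diag g by auto
  qed simp_all
  finally have "unitary_mat n (W * D)"
    using W D by (intro unitary_matI) auto
  moreover have "col (W * D) 0 = complex_of_real (1 / sqrt (g 0)) \<cdot>\<^sub>v v"
  proof -
    have "W * D = mat n n (\<lambda>(i, j). W $$ (i, j) * complex_of_real (1 / sqrt (g j)))"
      unfolding D_def by (rule mat_diag_mult_right[OF W])
    moreover have "W $$ (i, 0) = v $ i" if "i < n" for i
      using that n ws hdws by (simp add: W_def mat_of_cols_index)
    ultimately show ?thesis using n v by (intro eq_vecI) auto
  qed
  ultimately show ?thesis by (rule that)
qed

lemma four_block_mat_adjoint:
  fixes A :: "complex mat"
  assumes "A \<in> carrier_mat a a" "B \<in> carrier_mat b b"
  shows "mat_adjoint (four_block_mat A (0\<^sub>m a b) (0\<^sub>m b a) B) =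
    four_block_mat (mat_adjoint A) (0\<^sub>m a b) (0\<^sub>m b a) (mat_adjoint B)"
  using assms by (intro eq_matI) auto

text \<open>Deflation: in an orthonormal basis that starts with an eigenvector, the first column is
  e times a unit vector, Hermitian symmetry clears the first row as well, and a Hermitian block of
  size m is left for the induction.\<close>

theorem hermitian_spectral_form:
  assumes "A \<in> carrier_mat n n" and "mat_adjoint A = A"
  shows "\<exists>U d. unitary_mat n U \<and> A = spectral_form n U d"
  using assms
proof (induction n arbitrary: A)
  case 0
  then show ?case
    by (intro exI[of _ "1\<^sub>m 0"] exI[of _ "\<lambda>_. 0"] conjI unitary_mat_one eq_matI)
      (auto simp: spectral_form_def)
next
  case (Suc m)
  let ?n = "Suc m"
  note A = Suc.prems
  note as = assoc_mult_mat[of _ ?n ?n _ ?n _ ?n] mult_carrier_mat[of _ ?n ?n _ ?n]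
  obtain e where "eigenvalue A e"
    using spectrum_non_empty[OF A(1)] by (auto simp: spectrum_def)
  then obtain v where v: "v \<in> carrier_vec ?n" "v \<noteq> 0\<^sub>v ?n" "A *\<^sub>v v = e \<cdot>\<^sub>v v"
    using A(1) by (auto simp: eigenvalue_def eigenvector_def)
  obtain U c where U: "unitary_mat ?n U" and Uc: "col U 0 = c \<cdot>\<^sub>v v"
    by (rule exists_unitary_first_col[OF v(1,2)])
  note u = unitary_matD[OF U]
  define A' where "A' = mat_adjoint U * A * U"
  have A': "A' \<in> carrier_mat ?n ?n" using A u by (simp add: A'_def)
  have A'h: "mat_adjoint A' = A'"
    using A u by (simp add: A'_def mat_adjoint_mult[of _ ?n ?n _ ?n] as)
  have AA': "A = U * A' * mat_adjoint U"
  proof -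
    have "U * A' * mat_adjoint U = (U * mat_adjoint U) * A * (U * mat_adjoint U)"
      using A(1) u(1,2) by (simp add: A'_def as)
    then show ?thesis using A u by simp
  qed
  have "A *\<^sub>v col U 0 = e \<cdot>\<^sub>v col U 0"
    using A(1) v by (simp add: Uc mult_mat_vec smult_smult_assoc mult.commute)
  then have "col (A * U) 0 = e \<cdot>\<^sub>v col U 0"
    by (subst col_mult2[OF A(1) u(1)]) simp_all
  then have "col A' 0 = mat_adjoint U *\<^sub>v (e \<cdot>\<^sub>v col U 0)"
    using A(1) u(1,2) by (subst A'_def, subst as(1), auto)
  also have "\<dots> = e \<cdot>\<^sub>v col (mat_adjoint U * U) 0"
    using u(1,2) mult_mat_vec[OF u(2), of "col U 0" e] by auto
  finally have "col A' 0 = e \<cdot>\<^sub>v col (1\<^sub>m ?n) 0" using u by simp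
  then have "A' $$ (i, 0) = (if i = 0 then e else 0)" if "i < ?n" for i
    using that A' by (auto dest!: arg_cong[where f="\<lambda>w. w $ i"])
  note col0 = this
  have row0: "A' $$ (0, i) = cnj (A' $$ (i, 0))" if "i < ?n" for i
    using A'h A' that by (metis index_mat_adjoint carrier_matD zero_less_Suc)
  \<comment> \<open>The corner entry equals its own conjugate, so the eigenvalue is real.\<close>
  have e: "complex_of_real (Re e) = e"
    using row0[of 0] col0[of 0] by (simp add: complex_eq_iff)
  define B where "B = mat m m (\<lambda>(i, j). A' $$ (Suc i, Suc j))"
  have B: "B \<in> carrier_mat m m" by (simp add: B_def)
  have "mat_adjoint B = B"
  proof (rule eq_matI)
    fix i j assume "i < dim_row B" "j < dim_col B"
    then have ij: "i < m" "j < m" by (auto simp: B_def)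
    have "cnj (A' $$ (Suc j, Suc i)) = A' $$ (Suc i, Suc j)"
      using ij A'h A' by (metis index_mat_adjoint carrier_matD Suc_less_eq)
    then show "mat_adjoint B $$ (i, j) = B $$ (i, j)" using ij by (simp add: B_def)
  qed (simp_all add: B_def)
  from Suc.IH[OF B this] obtain V f where V: "unitary_mat m V" and Bf: "B = spectral_form m V f"
    by blast
  note w = unitary_matD[OF V]
  let ?blk = "\<lambda>X Y. four_block_mat X (0\<^sub>m 1 m) (0\<^sub>m m 1) Y :: complex mat"
  have blk_mult: "?blk X Y * ?blk X' Y' = ?blk (X * X') (Y * Y')"
    if "X \<in> carrier_mat 1 1" "X' \<in> carrier_mat 1 1" "Y \<in> carrier_mat m m" "Y' \<in> carrier_mat m m"
    for X Y X' Y'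
    using that by (subst mult_four_block_mat[of _ 1 1 _ m _ m _ _ 1 _ m]) auto
  define V1 where "V1 = ?blk (1\<^sub>m 1) V"
  have V1: "V1 \<in> carrier_mat ?n ?n"
    using w four_block_carrier_mat[of "1\<^sub>m 1" 1 1 V m m] by (simp add: V1_def)
  have V1a: "mat_adjoint V1 = ?blk (1\<^sub>m 1) (mat_adjoint V)"
    using w by (simp add: V1_def four_block_mat_adjoint)
  have one: "?blk (1\<^sub>m 1) (1\<^sub>m m) = 1\<^sub>m ?n"
    by (rule eq_matI) auto
  have V1u: "unitary_mat ?n V1"
    using w V1 by (intro unitary_matI) (simp_all add: V1a del: One_nat_def,
      simp add: V1_def blk_mult one plus_1_eq_Suc del: One_nat_def)
  define d where "d = case_nat (Re e) f"
  have A'blk: "A' = ?blk (mat 1 1 (\<lambda>_. e)) B"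
  proof (rule eq_matI)
    fix i j assume "i < dim_row (?blk (mat 1 1 (\<lambda>_. e)) B)" "j < dim_col (?blk (mat 1 1 (\<lambda>_. e)) B)"
    then have ij: "i < ?n" "j < ?n" by (auto simp: B_def)
    show "A' $$ (i, j) = ?blk (mat 1 1 (\<lambda>_. e)) B $$ (i, j)"
      using ij col0 row0[OF ij(2)] col0[OF ij(2)] e
      by (cases i; cases j) (auto simp: B_def complex_eq_iff)
  qed (use A' in \<open>auto simp: B_def\<close>)
  have dblk: "mat_diag ?n (\<lambda>i. complex_of_real (d i)) =
      ?blk (mat 1 1 (\<lambda>_. e)) (mat_diag m (\<lambda>i. complex_of_real (f i)))"
    using e by (intro eq_matI) (auto simp: mat_diag_def d_def split: nat.splits)
  have "spectral_form ?n V1 d = A'"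
    using w unfolding spectral_form_def dblk V1a A'blk Bf
    by (simp add: V1_def blk_mult mult_carrier_mat[of _ m m _ m] del: One_nat_def)
  then have "A = U * spectral_form ?n V1 d * mat_adjoint U" using AA' by simp
  also have "\<dots> = spectral_form ?n (U * V1) d"
    using u(1,2) V1 mat_adjoint_carrier[OF V1]
    by (simp add: spectral_form_def mat_adjoint_mult[OF u(1) V1] as)
  finally show ?case using unitary_mat_mult[OF U V1u] by blast
qed

section \<open>Spectral forms and overlaps of eigenbases\<close>

lemma cmod_sq_mult_cnj: "complex_of_real ((cmod z)\<^sup>2) = z * cnj z"
  by (simp only: complex_norm_square)

lemma unitary_row_sum:
  assumes W: "unitary_mat n W" and i: "i < n"
  shows "(\<Sum>j<n. (cmod (W $$ (i, j)))\<^sup>2) = 1"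
proof -
  note w = unitary_matD[OF W]
  have "(W * mat_adjoint W) $$ (i, i) = (\<Sum>j<n. complex_of_real ((cmod (W $$ (i, j)))\<^sup>2))"
    unfolding cmod_sq_mult_cnj using w(1) i by (simp add: scalar_prod_def atLeast0LessThan)
  then have "complex_of_real (\<Sum>j<n. (cmod (W $$ (i, j)))\<^sup>2) = 1"
    using w i by simp
  then show ?thesis unfolding of_real_eq_1_iff .
qed

lemma unitary_col_sum:
  assumes W: "unitary_mat n W" and j: "j < n"
  shows "(\<Sum>i<n. (cmod (W $$ (i, j)))\<^sup>2) = 1"
  using unitary_row_sum[OF unitary_mat_adjoint[OF W] j] unitary_matD(1)[OF W] j by simp

text \<open>Squared modulus of the inner product of column i of U with column j of V. For unitary
  matrices it is doubly stochastic: the transition matrix between two eigenbases.\<close>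

definition overlap :: "complex mat \<Rightarrow> complex mat \<Rightarrow> nat \<Rightarrow> nat \<Rightarrow> real" where
  "overlap U V i j = (cmod ((mat_adjoint U * V) $$ (i, j)))\<^sup>2"

lemma overlap_nonneg: "0 \<le> overlap U V i j"
  by (simp add: overlap_def)

lemma overlap_sum:
  assumes "unitary_mat n U" "unitary_mat n V"
  shows "i < n \<Longrightarrow> (\<Sum>j<n. overlap U V i j) = 1" "j < n \<Longrightarrow> (\<Sum>i<n. overlap U V i j) = 1"
  unfolding overlap_def using unitary_mat_mult[OF unitary_mat_adjoint[OF assms(1)] assms(2)]
  by (auto intro: unitary_row_sum unitary_col_sum)

lemma overlap_sum_left:
  assumes "unitary_mat n U" "unitary_mat n V"
  shows "(\<Sum>i<n. \<Sum>j<n. overlap U V i j * f i) = (\<Sum>i<n. f i)"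
  using overlap_sum(1)[OF assms] by (simp add: sum_distrib_right[symmetric])

lemma overlap_sum_right:
  assumes "unitary_mat n U" "unitary_mat n V"
  shows "(\<Sum>i<n. \<Sum>j<n. overlap U V i j * f j) = (\<Sum>j<n. f j)"
  by (subst sum.swap) (use overlap_sum(2)[OF assms] in \<open>simp add: sum_distrib_right[symmetric]\<close>)

lemma spectral_form_cong:
  assumes "\<And>i. i < n \<Longrightarrow> d i = e i"
  shows "spectral_form n U d = spectral_form n U e"
proof -
  have "mat_diag n (\<lambda>i. complex_of_real (d i)) = mat_diag n (\<lambda>i. complex_of_real (e i))"
    by (rule eq_matI) (auto simp: mat_diag_def assms)
  then show ?thesis by (simp add: spectral_form_def)
qed

text \<open>With \<open>W = mat_adjoint U * V\<close> the product is \<open>mat_adjoint W\<close>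
  times a diagonal matrix times W, and on its diagonal only squared moduli of W survive. Averages
  with overlap weights enter here.\<close>

lemma spectral_form_conj_diag:
  assumes U: "unitary_mat n U" and V: "unitary_mat n V" and k: "k < n"
  shows "(mat_adjoint V * spectral_form n U d * V) $$ (k, k) =
    complex_of_real (\<Sum>i<n. overlap U V i k * d i)"
proof -
  note u = unitary_matD[OF U] and v = unitary_matD[OF V]
  note as = assoc_mult_mat[of _ n n _ n _ n] mult_carrier_mat[of _ n n _ n]
  let ?D = "mat_diag n (\<lambda>i. complex_of_real (d i))"
  define W where "W = mat_adjoint U * V"
  have W: "W \<in> carrier_mat n n" using u v by (simp add: W_def as)
  have Wa: "mat_adjoint W = mat_adjoint V * U"
    using u v by (simp add: W_def mat_adjoint_mult[of _ n n _ n])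
  have "mat_adjoint V * spectral_form n U d * V = mat_adjoint W * (?D * W)"
    unfolding Wa using u(1,2) v(1,2) by (simp add: W_def spectral_form_def as)
  also have "?D * W = mat n n (\<lambda>(i, j). complex_of_real (d i) * W $$ (i, j))"
    by (rule mat_diag_mult_left[OF W])
  also have "(mat_adjoint W * \<dots>) $$ (k, k) = (\<Sum>i<n. complex_of_real (overlap U V i k * d i))"
    using W k by (auto simp: overlap_def W_def[symmetric] scalar_prod_def atLeast0LessThan
        cmod_sq_mult_cnj mult_ac simp del: of_real_power intro!: sum.cong)
  finally show ?thesis by simp
qed

lemma spectral_form_diagonalizes:
  assumes U: "unitary_mat n U" and k: "k < n"
  shows "(mat_adjoint U * spectral_form n U d * U) $$ (k, k) = complex_of_real (d k)"
proof -
  have "overlap U U i k = (if i = k then 1 else 0)" if "i < n" for i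
    using that k unitary_matD(3)[OF U] by (simp add: overlap_def)
  then have "(\<Sum>i<n. overlap U U i k * d i) = d k"
    using k by (simp add: if_distrib[of "\<lambda>x. x * _"] cong: if_cong)
  then show ?thesis by (simp add: spectral_form_conj_diag[OF U U k])
qed

lemma mat_trace_conj:
  assumes U: "unitary_mat n U" and A: "A \<in> carrier_mat n n"
  shows "mat_trace (U * A * mat_adjoint U) = mat_trace A"
proof -
  note u = unitary_matD[OF U]
  note as = assoc_mult_mat[of _ n n _ n _ n] mult_carrier_mat[of _ n n _ n]
  have "mat_trace (U * A * mat_adjoint U) = mat_trace (mat_adjoint U * (U * A))"
    using u A by (intro mat_trace_comm) auto
  also have "mat_adjoint U * (U * A) = (mat_adjoint U * U) * A"
    using u(1,2) A by (simp add: as)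
  finally show ?thesis using u A by simp
qed

lemma spectral_form_trace:
  assumes U: "unitary_mat n U"
  shows "mat_trace (spectral_form n U d) = complex_of_real (\<Sum>i<n. d i)"
  unfolding spectral_form_def
  by (subst mat_trace_conj[OF U]) (simp_all add: mat_trace_def mat_diag_def)

lemma spectral_form_mult:
  assumes U: "unitary_mat n U"
  shows "spectral_form n U d * spectral_form n U e = spectral_form n U (\<lambda>i. d i * e i)"
proof -
  note u = unitary_matD[OF U]
  note as = assoc_mult_mat[of _ n n _ n _ n] mult_carrier_mat[of _ n n _ n] mat_diag_dim
  let ?D = "\<lambda>d. mat_diag n (\<lambda>i. complex_of_real (d i))"
  have "spectral_form n U d * spectral_form n U e = U * ?D d * (mat_adjoint U * U) * ?D e * mat_adjoint U"
    using u(1,2) by (simp add: spectral_form_def as del: mat_diag_diag)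
  also have "\<dots> = U * (?D d * ?D e) * mat_adjoint U"
    using u by (simp add: as left_mult_one_mat[of _ n n] del: mat_diag_diag)
  finally show ?thesis by (simp add: spectral_form_def)
qed

lemma vn_entropy_spectral_form:
  assumes U: "unitary_mat n U"
  shows "vn_entropy (spectral_form n U d) = - (\<Sum>i<n. d i * ln (d i)) / ln 2"
  unfolding vn_entropy_def mat_fun_eq[OF U] spectral_form_mult[OF U] spectral_form_trace[OF U]
  by (simp add: log_def sum_divide_distrib)

lemma spectral_form_smult:
  assumes U: "unitary_mat n U"
  shows "complex_of_real c \<cdot>\<^sub>m spectral_form n U d = spectral_form n U (\<lambda>i. c * d i)"
proof -
  note u = unitary_matD[OF U]
  note mc = mult_carrier_mat[of _ n n _ n]
  let ?D = "mat_diag n (\<lambda>i. complex_of_real (d i))"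
  have "mat_diag n (\<lambda>i. complex_of_real (c * d i)) = complex_of_real c \<cdot>\<^sub>m ?D"
    by (rule eq_matI) (auto simp: mat_diag_def)
  then show ?thesis
    using u by (simp add: spectral_form_def mult_smult_distrib[of _ n n _ n]
        mult_smult_assoc_mat[of _ n n _ n] mc)
qed

lemma spectral_form_add:
  assumes U: "unitary_mat n U"
  shows "spectral_form n U d + spectral_form n U e = spectral_form n U (\<lambda>i. d i + e i)"
proof -
  note u = unitary_matD[OF U]
  let ?D = "\<lambda>d. mat_diag n (\<lambda>i. complex_of_real (d i))"
  have "mat_diag n (\<lambda>i. complex_of_real (d i + e i)) = ?D d + ?D e"
    by (rule eq_matI) (auto simp: mat_diag_def)
  then show ?thesis
    using u by (simp add: spectral_form_def mult_add_distrib_mat[of _ n n _ n]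
        add_mult_distrib_mat[of _ n n _ _ n] mult_carrier_mat[of _ n n _ n])
qed

lemma spectral_form_const:
  assumes U: "unitary_mat n U"
  shows "spectral_form n U (\<lambda>_. c) = complex_of_real c \<cdot>\<^sub>m 1\<^sub>m n"
proof -
  have "spectral_form n U (\<lambda>_. 1) = 1\<^sub>m n"
    using unitary_matD[OF U] by (simp add: spectral_form_def)
  then show ?thesis using spectral_form_smult[OF U, of c "\<lambda>_. 1"] by simp
qed

lemma spectral_form_adjoint:
  assumes U: "unitary_mat n U"
  shows "mat_adjoint (spectral_form n U d) = spectral_form n U d"
  using unitary_matD[OF U] mat_adjoint_diag_real[of n d]
  by (simp add: spectral_form_def mat_adjoint_mult[of _ n n _ n] assoc_mult_mat[of _ n n _ n _ n]
      mult_carrier_mat[of _ n n _ n])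

lemma spectral_form_det:
  assumes U: "unitary_mat n U"
  shows "det (spectral_form n U d) = complex_of_real (\<Prod>i<n. d i)"
proof -
  note u = unitary_matD[OF U]
  let ?D = "mat_diag n (\<lambda>i. complex_of_real (d i))"
  have uu: "det U * det (mat_adjoint U) = 1"
    using det_mult[OF u(1,2)] u by simp
  have "det ?D = prod_list (diag_mat ?D)"
    by (rule det_upper_triangular[of _ n]) (auto simp: mat_diag_def)
  also have "\<dots> = (\<Prod>i<n. complex_of_real (d i))"
    by (auto simp: diag_mat_def mat_diag_def prod.list_conv_set_nth atLeast0LessThan intro!: prod.cong)
  finally have D: "det ?D = complex_of_real (\<Prod>i<n. d i)" by simp
  have "det (spectral_form n U d) = det U * det ?D * det (mat_adjoint U)"
    using u by (simp add: spectral_form_def det_mult[of _ n] mult_carrier_mat[of _ n n _ n])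
  also have "\<dots> = det ?D * (det U * det (mat_adjoint U))" by (simp only: mult_ac)
  finally show ?thesis using uu D by simp
qed

lemma psd_spectral_form:
  assumes A: "psd_mat n A"
  obtains U d where "unitary_mat n U" "A = spectral_form n U d" "\<And>i. i < n \<Longrightarrow> 0 \<le> d i"
proof -
  have "A \<in> carrier_mat n n" using A by (simp add: psd_mat_def)
  then obtain U d where U: "unitary_mat n U" and Ud: "A = spectral_form n U d"
    using hermitian_spectral_form psd_mat_hermitian[OF A] by blast
  have "0 \<le> d i" if "i < n" for i
    using psd_mat_diag_nonneg[OF psd_mat_congruence[OF A unitary_matD(2)[OF U]] that]
      spectral_form_diagonalizes[OF U that, of d] Ud
    by (simp add: less_eq_complex_def)
  then show ?thesis using that U Ud by blast
qed

lemma mult_adjoint_psd: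
  assumes "B \<in> carrier_mat n m"
  shows "psd_mat n (B * mat_adjoint B)"
proof -
  have "psd_mat m (1\<^sub>m m)"
    by (auto simp: psd_mat_def)
  from psd_mat_congruence[OF this assms] show ?thesis
    using assms by simp
qed

lemma spectral_form_psd:
  assumes U: "unitary_mat n U" and d: "\<And>i. i < n \<Longrightarrow> 0 \<le> d i"
  shows "psd_mat n (spectral_form n U d)"
proof -
  have "spectral_form n U d = spectral_form n U (\<lambda>i. sqrt (d i) * sqrt (d i))"
    by (rule spectral_form_cong) (simp add: d)
  then show ?thesis
    using mult_adjoint_psd[OF spectral_form_carrier[OF U], of "\<lambda>i. sqrt (d i)"]
    by (simp add: spectral_form_adjoint[OF U] spectral_form_mult[OF U])
qed

lemma psd_mat_add:
  assumes "psd_mat n A" "psd_mat n B"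
  shows "psd_mat n (A + B)"
  using assms unfolding psd_mat_def
  by (auto simp: add_mult_distrib_mat_vec[of _ n n] add_scalar_prod_distrib[of _ n])

lemma psd_mat_smult:
  assumes "psd_mat n A" "0 \<le> c"
  shows "psd_mat n (complex_of_real c \<cdot>\<^sub>m A)"
proof -
  obtain U d where U: "unitary_mat n U" and A: "A = spectral_form n U d" and d: "\<And>i. i < n \<Longrightarrow> 0 \<le> d i"
    using psd_spectral_form[OF assms(1)] by blast
  show ?thesis unfolding A spectral_form_smult[OF U]
    by (rule spectral_form_psd[OF U]) (use d assms in auto)
qed

lemma psd_mat_mean:
  assumes "psd_mat n A" "psd_mat n B"
  shows "psd_mat n ((1/2) \<cdot>\<^sub>m (A + B))"
  using psd_mat_smult[OF psd_mat_add[OF assms], of "1/2"] by simp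

text \<open>The two summands need not be diagonal in the eigenbasis of their mean, but diagonal
  entries are additive, so only their overlap averages count.\<close>

lemma mean_eigenvalue:
  assumes U: "unitary_mat n U" and V: "unitary_mat n V" and W: "unitary_mat n W"
    and M: "(1/2) \<cdot>\<^sub>m (spectral_form n U x + spectral_form n V y) = spectral_form n W m"
    and k: "k < n"
  shows "m k = ((\<Sum>i<n. overlap U W i k * x i) + (\<Sum>j<n. overlap V W j k * y j)) / 2"
proof -
  note w = unitary_matD[OF W] and c = spectral_form_carrier[OF U, of x] spectral_form_carrier[OF V, of y]
  note mc = mult_carrier_mat[of _ n n _ n]
  let ?X = "spectral_form n U x" and ?Y = "spectral_form n V y"
  have "mat_adjoint W * ((1/2) \<cdot>\<^sub>m (?X + ?Y)) * W =
      (1/2) \<cdot>\<^sub>m (mat_adjoint W * ?X * W + mat_adjoint W * ?Y * W)"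
    using w c by (simp add: mult_smult_distrib[of _ n n _ n] mult_smult_assoc_mat[of _ n n _ n]
        mult_add_distrib_mat[of _ n n _ n] add_mult_distrib_mat[of _ n n _ _ n] mc)
  moreover have "mat_adjoint W * ?X * W \<in> carrier_mat n n" "mat_adjoint W * ?Y * W \<in> carrier_mat n n"
    using w c by (simp_all add: mc)
  ultimately have "complex_of_real (m k) = (1/2) * ((mat_adjoint W * ?X * W) $$ (k, k) + (mat_adjoint W * ?Y * W) $$ (k, k))"
    using k unfolding M spectral_form_diagonalizes[OF W k, of m, symmetric] by auto
  also have "\<dots> = complex_of_real (((\<Sum>i<n. overlap U W i k * x i) + (\<Sum>j<n. overlap V W j k * y j)) / 2)"
    by (simp only: spectral_form_conj_diag[OF U W k] spectral_form_conj_diag[OF V W k]) simp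
  finally show ?thesis unfolding of_real_eq_iff .
qed

section \<open>The triangle inequality for the log-determinant gap\<close>

lemma sinh_ge_self: "x \<le> sinh x" if "0 \<le> x" for x :: real
proof -
  have "sinh 0 - 0 \<le> sinh x - x"
    by (rule DERIV_nonneg_imp_nondecreasing[OF that])
      (auto intro!: exI derivative_eq_intros simp: cosh_real_ge_1)
  then show ?thesis by simp
qed

text \<open>This is the sign condition for \<open>ln (cosh y) / y\<^sup>2\<close> to decrease. The
  difference of the sides has derivative (sinh y cosh y - y) / cosh^2 y, which is nonnegative
  because sinh y \<ge> y and cosh y \<ge> 1.\<close>

lemma tanh_le_two_ln_cosh:
  assumes "0 \<le> (x :: real)"
  shows "x * (sinh x / cosh x) \<le> 2 * ln (cosh x)"
proof -
  have "2 * ln (cosh 0) - 0 * (sinh 0 / cosh 0) \<le> 2 * ln (cosh x) - x * (sinh x / cosh x)"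
  proof (rule DERIV_nonneg_imp_nondecreasing[OF assms])
    fix y :: real assume y: "0 \<le> y" "y \<le> x"
    have c: "cosh y > 0" by simp
    have "((\<lambda>x. 2 * ln (cosh x) - x * (sinh x / cosh x)) has_real_derivative
        (sinh y * cosh y - y * ((cosh y)\<^sup>2 - (sinh y)\<^sup>2)) / (cosh y)\<^sup>2) (at y)"
      using c by (auto intro!: derivative_eq_intros simp: field_simps power2_eq_square)
    moreover have "0 \<le> (sinh y * cosh y - y * ((cosh y)\<^sup>2 - (sinh y)\<^sup>2)) / (cosh y)\<^sup>2"
    proof -
      have "y * 1 \<le> sinh y * cosh y"
        using y sinh_ge_self[of y] cosh_real_ge_1[of y] by (intro mult_mono) auto
      then show ?thesis by (simp add: cosh_square_eq)
    qed
    ultimately show "\<exists>d. ((\<lambda>x. 2 * ln (cosh x) - x * (sinh x / cosh x)) has_real_derivative d) (at y) \<and> 0 \<le> d"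
      by blast
  qed
  then show ?thesis by simp
qed

text \<open>Equivalently, sqrt (ln (cosh w)) / w is nonincreasing; a nonnegative function with this
  property is subadditive.\<close>

lemma ln_cosh_scale:
  fixes w t :: real
  assumes w: "0 \<le> w" and t: "0 \<le> t" "t \<le> 1"
  shows "t\<^sup>2 * ln (cosh w) \<le> ln (cosh (t * w))"
proof (cases "t * w = 0")
  case True
  then show ?thesis by (cases "t = 0") auto
next
  case False
  then have pos: "0 < t" "0 < w" "0 < t * w" using w t by auto
  have "ln (cosh w) / w\<^sup>2 \<le> ln (cosh (t * w)) / (t * w)\<^sup>2"
  proof (rule DERIV_nonpos_imp_nonincreasing[of "t * w" w])
    show "t * w \<le> w" using w t by (simp add: mult_left_le_one_le)
    fix y assume y: "t * w \<le> y" "y \<le> w"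
    then have y0: "0 < y" using pos by linarith
    have c: "cosh y > 0" by simp
    have "((\<lambda>y. ln (cosh y) / y\<^sup>2) has_real_derivative
        (y * (sinh y / cosh y) - 2 * ln (cosh y)) / y ^ 3) (at y)"
      using y0 c by (auto intro!: derivative_eq_intros simp: field_simps power2_eq_square power3_eq_cube)
    moreover have "(y * (sinh y / cosh y) - 2 * ln (cosh y)) / y ^ 3 \<le> 0"
      using tanh_le_two_ln_cosh[of y] y0 by (intro divide_nonpos_pos) auto
    ultimately show "\<exists>d. ((\<lambda>y. ln (cosh y) / y\<^sup>2) has_real_derivative d) (at y) \<and> d \<le> 0"
      by blast
  qed
  then show ?thesis using pos by (simp add: field_simps power_mult_distrib)
qed

text \<open>|u| and |v| are fractions t and 1 - t of w = |u| + |v|, so \<open>ln_cosh_scale\<close>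
  bounds both terms on the right below by multiples of ln (cosh w).\<close>

lemma ln_cosh_triangle:
  fixes u v s :: real
  assumes s: "0 < s"
  shows "ln (cosh (u + v)) \<le> (1 + s) * ln (cosh u) + (1 + 1/s) * ln (cosh v)"
proof (cases "\<bar>u\<bar> + \<bar>v\<bar> = 0")
  case False
  define w where "w = \<bar>u\<bar> + \<bar>v\<bar>"
  define t where "t = \<bar>u\<bar> / w"
  have w: "0 < w" using False by (simp add: w_def)
  have t: "0 \<le> t" "t \<le> 1" "t * w = \<bar>u\<bar>" "(1 - t) * w = \<bar>v\<bar>"
    using w by (auto simp: t_def w_def field_simps)
  have L: "0 \<le> ln (cosh w)" by (simp add: cosh_real_ge_1)
  have "cosh (u + v) \<le> cosh w"
    using cosh_real_nonneg_le_iff[of "\<bar>u + v\<bar>" w] by (simp add: w_def abs_triangle_ineq)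
  then have "ln (cosh (u + v)) \<le> 1 * ln (cosh w)" by simp
  also have "\<dots> \<le> ((1 + s) * t\<^sup>2 + (1 + 1/s) * (1 - t)\<^sup>2) * ln (cosh w)"
  proof (rule mult_right_mono[OF _ L])
    \<comment> \<open>Expand 1 as the square of t + (1 - t); the remainder is a perfect square
      divided by s.\<close>
    have "(1 + s) * t\<^sup>2 + (1 + 1/s) * (1 - t)\<^sup>2 = 1 + (s * t - (1 - t))\<^sup>2 / s"
      using s by (simp add: field_simps power2_eq_square)
    then show "1 \<le> (1 + s) * t\<^sup>2 + (1 + 1/s) * (1 - t)\<^sup>2" using s by simp
  qed
  also have "\<dots> = (1 + s) * (t\<^sup>2 * ln (cosh w)) + (1 + 1/s) * ((1 - t)\<^sup>2 * ln (cosh w))"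
    by (simp add: algebra_simps)
  also have "\<dots> \<le> (1 + s) * ln (cosh u) + (1 + 1/s) * ln (cosh v)"
    using ln_cosh_scale[of w t] ln_cosh_scale[of w "1 - t"] w t s
    by (intro add_mono mult_left_mono) auto
  finally show ?thesis .
next
  case True
  then have "u = 0" "v = 0" by linarith+
  then show ?thesis by simp
qed

text \<open>Logarithm of the ratio of the arithmetic to the geometric mean.\<close>

definition ln_gap :: "real \<Rightarrow> real \<Rightarrow> real" where
  "ln_gap a b = ln ((a + b) / 2) - ln a / 2 - ln b / 2"

text \<open>With a = exp (2 p) and b = exp (2 q) the mean is exp (p + q) cosh (p - q). The gap thus
  depends only on a difference of logarithms, and differences add along a chain a, b, c.\<close>

lemma ln_gap_cosh:
  assumes "0 < a" "0 < b"
  shows "ln_gap a b = ln (cosh ((ln a - ln b) / 2))"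
proof -
  define p q where "p = ln a / 2" and "q = ln b / 2"
  have ab: "a = exp p * exp p" "b = exp q * exp q"
    using assms by (simp_all add: p_def q_def flip: exp_add)
  have "(a + b) / 2 = exp (p + q) * cosh (p - q)"
    by (simp add: ab cosh_def exp_diff exp_minus exp_add field_simps)
  then have "ln ((a + b) / 2) = (p + q) + ln (cosh (p - q))"
    by (simp add: ln_mult)
  then show ?thesis
    by (simp add: ln_gap_def p_def q_def diff_divide_distrib add_divide_distrib)
qed

lemma ln_gap_nonneg: "0 < a \<Longrightarrow> 0 < b \<Longrightarrow> 0 \<le> ln_gap a b"
  by (simp add: ln_gap_cosh cosh_real_ge_1)

lemma ln_gap_triangle:
  assumes "0 < a" "0 < b" "0 < c" "0 < s"
  shows "ln_gap a c \<le> (1 + s) * ln_gap a b + (1 + 1/s) * ln_gap b c"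
  using ln_cosh_triangle[OF assms(4), of "(ln a - ln b) / 2" "(ln b - ln c) / 2"] assms
  by (simp add: ln_gap_cosh diff_divide_distrib)

section \<open>Jensen's inequality for ln, and positive definite matrices\<close>

lemma weighted_sum_pos:
  fixes w x :: "'a \<Rightarrow> real"
  assumes "finite S" and w: "\<And>i. i \<in> S \<Longrightarrow> 0 \<le> w i" "sum w S = 1"
    and x: "\<And>i. i \<in> S \<Longrightarrow> 0 < x i"
  shows "0 < (\<Sum>i\<in>S. w i * x i)"
proof -
  obtain i where i: "i \<in> S" "w i \<noteq> 0"
    using w(2) sum.neutral[of S w] by fastforce
  then have "0 < w i * x i" using w(1)[OF i(1)] x[OF i(1)] by simp
  moreover have "0 \<le> w j * x j" if "j \<in> S" for j
    using w(1)[OF that] x[OF that] by simp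
  ultimately show ?thesis using assms(1) i(1) by (intro sum_pos2[of S i]) auto
qed

lemma sum_ln_le_ln_sum:
  fixes w x :: "'a \<Rightarrow> real"
  assumes "finite S" and w: "\<And>i. i \<in> S \<Longrightarrow> 0 \<le> w i" "sum w S = 1"
    and x: "\<And>i. i \<in> S \<Longrightarrow> 0 < x i"
  shows "(\<Sum>i\<in>S. w i * ln (x i)) \<le> ln (\<Sum>i\<in>S. w i * x i)"
proof -
  let ?m = "\<Sum>i\<in>S. w i * x i"
  have m: "0 < ?m" by (rule weighted_sum_pos[OF assms])
  have "w i * ln (x i) \<le> w i * (ln ?m + (x i / ?m - 1))" if "i \<in> S" for i
  proof (rule mult_left_mono[OF _ w(1)[OF that]])
    \<comment> \<open>The tangent to ln at the mean; its linear part averages to zero.\<close>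
    show "ln (x i) \<le> ln ?m + (x i / ?m - 1)"
      using ln_le_minus_one[of "x i / ?m"] x[OF that] m by (simp add: ln_div)
  qed
  then have "(\<Sum>i\<in>S. w i * ln (x i)) \<le> (\<Sum>i\<in>S. w i * (ln ?m - 1) + w i * x i / ?m)"
    by (intro sum_mono) (simp add: algebra_simps)
  also have "\<dots> = ln ?m"
    using w m by (simp add: sum.distrib sum_distrib_right[symmetric] sum_divide_distrib[symmetric])
  finally show ?thesis .
qed

text \<open>In this form, stability under an invertible congruence follows at once from
  multiplicativity of the determinant.\<close>

definition pos_def :: "nat \<Rightarrow> complex mat \<Rightarrow> bool" where
  "pos_def n A \<longleftrightarrow> psd_mat n A \<and> det A \<noteq> 0"

definition ln_det :: "complex mat \<Rightarrow> real" where
  "ln_det A = ln (Re (det A))"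

lemma pos_def_spectral_form_iff:
  assumes U: "unitary_mat n U"
  shows "pos_def n (spectral_form n U d) \<longleftrightarrow> (\<forall>i<n. 0 < d i)"
proof
  assume A: "pos_def n (spectral_form n U d)"
  show "\<forall>i<n. 0 < d i"
  proof (intro allI impI)
    fix i assume i: "i < n"
    have "psd_mat n (mat_adjoint U * spectral_form n U d * U)"
      using A psd_mat_congruence[of n "spectral_form n U d" "mat_adjoint U" n] unitary_matD[OF U]
      by (simp add: pos_def_def)
    then have "0 \<le> d i"
      using psd_mat_diag_nonneg[OF _ i] spectral_form_diagonalizes[OF U i, of d]
      by (fastforce simp: less_eq_complex_def)
    moreover have "d i \<noteq> 0"
      using A i by (auto simp: pos_def_def spectral_form_det[OF U])
    ultimately show "0 < d i" by simp
  qed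
next
  assume d: "\<forall>i<n. 0 < d i"
  then have "0 < (\<Prod>i<n. d i)" by (auto intro: prod_pos)
  then show "pos_def n (spectral_form n U d)"
    using d unfolding pos_def_def spectral_form_det[OF U] of_real_eq_0_iff
    by (auto intro!: spectral_form_psd[OF U] less_imp_le)
qed

lemma ln_det_spectral_form:
  assumes U: "unitary_mat n U" and d: "\<And>i. i < n \<Longrightarrow> 0 < d i"
  shows "ln_det (spectral_form n U d) = (\<Sum>i<n. ln (d i))"
proof -
  have "ln (\<Prod>i<n. d i) = (\<Sum>i<n. ln (d i))"
    by (rule ln_prod) (use d in \<open>force dest: less_imp_neq\<close>)+
  then show ?thesis
    unfolding ln_det_def spectral_form_det[OF U] Re_complex_of_real .
qed

lemma pos_def_spectral_form:
  assumes A: "pos_def n A"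
  obtains U d where "unitary_mat n U" "A = spectral_form n U d" "\<And>i. i < n \<Longrightarrow> 0 < d i"
proof -
  obtain U d where "unitary_mat n U" "A = spectral_form n U d"
    using A psd_spectral_form unfolding pos_def_def by blast
  then show ?thesis using that A pos_def_spectral_form_iff by blast
qed

lemma pos_def_mean:
  assumes "pos_def n A" "pos_def n B"
  shows "pos_def n ((1/2) \<cdot>\<^sub>m (A + B))"
proof -
  obtain U x where U: "unitary_mat n U" "A = spectral_form n U x" and x: "\<And>i. i < n \<Longrightarrow> 0 < x i"
    using pos_def_spectral_form[OF assms(1)] by blast
  obtain V y where V: "unitary_mat n V" "B = spectral_form n V y" and y: "\<And>i. i < n \<Longrightarrow> 0 < y i"
    using pos_def_spectral_form[OF assms(2)] by blast
  have "psd_mat n ((1/2) \<cdot>\<^sub>m (A + B))"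
    using assms by (simp add: pos_def_def psd_mat_mean)
  then obtain W m where W: "unitary_mat n W" and M: "(1/2) \<cdot>\<^sub>m (A + B) = spectral_form n W m"
    using psd_spectral_form by blast
  have "0 < m k" if k: "k < n" for k
  proof -
    have "0 < (\<Sum>i<n. overlap U W i k * x i)" "0 < (\<Sum>i<n. overlap V W i k * y i)"
      using x y overlap_sum(2)[OF U(1) W k] overlap_sum(2)[OF V(1) W k]
      by (auto intro!: weighted_sum_pos overlap_nonneg)
    then show ?thesis
      using mean_eigenvalue[OF U(1) V(1) W M[unfolded U(2) V(2)] k] by simp
  qed
  then show ?thesis unfolding M by (simp add: pos_def_spectral_form_iff[OF W])
qed

text \<open>The symmetric Stein divergence, also called Jensen-Bregman log-determinant
  divergence.\<close>

definition ln_det_gap :: "complex mat \<Rightarrow> complex mat \<Rightarrow> real" where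
  "ln_det_gap A B = ln_det ((1/2) \<cdot>\<^sub>m (A + B)) - ln_det A / 2 - ln_det B / 2"

text \<open>With k ranging over an eigenbasis of the mean, C i j is the sum over k of the product of the overlaps of
  k with the i-th and the j-th eigenvector.\<close>

lemma ln_det_gap_ge_coupling:
  assumes U: "unitary_mat n U" and V: "unitary_mat n V"
    and x: "\<And>i. i < n \<Longrightarrow> 0 < x i" and y: "\<And>i. i < n \<Longrightarrow> 0 < y i"
  obtains C where "\<And>i j. 0 \<le> C i j"
    "\<And>i. i < n \<Longrightarrow> (\<Sum>j<n. C i j) = 1" "\<And>j. j < n \<Longrightarrow> (\<Sum>i<n. C i j) = 1"
    "(\<Sum>i<n. \<Sum>j<n. C i j * ln_gap (x i) (y j)) \<le> ln_det_gap (spectral_form n U x) (spectral_form n V y)"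
proof -
  let ?X = "spectral_form n U x" and ?Y = "spectral_form n V y"
  have "psd_mat n ?X" "psd_mat n ?Y"
    using x y by (auto intro!: spectral_form_psd U V less_imp_le)
  then have "psd_mat n ((1/2) \<cdot>\<^sub>m (?X + ?Y))" by (rule psd_mat_mean)
  then obtain W m where W: "unitary_mat n W" and M: "(1/2) \<cdot>\<^sub>m (?X + ?Y) = spectral_form n W m"
    using psd_spectral_form by blast
  define a b where "a = overlap U W" and "b = overlap V W"
  have nonneg: "0 \<le> a i k" "0 \<le> b i k" for i k by (simp_all add: a_def b_def overlap_nonneg)
  have asum: "i < n \<Longrightarrow> (\<Sum>k<n. a i k) = 1" "k < n \<Longrightarrow> (\<Sum>i<n. a i k) = 1" for i k
    using overlap_sum[OF U W] by (simp_all add: a_def)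
  have bsum: "i < n \<Longrightarrow> (\<Sum>k<n. b i k) = 1" "k < n \<Longrightarrow> (\<Sum>i<n. b i k) = 1" for i k
    using overlap_sum[OF V W] by (simp_all add: b_def)
  \<comment> \<open>For fixed k the products \<open>a i k * b j k\<close> form a product
    distribution on pairs (i, j), under which (x i + y j) / 2 has mean \<open>m k\<close>; this is
    the distribution used in Jensen's inequality.\<close>
  have mk: "m k = (\<Sum>(i, j)\<in>{..<n} \<times> {..<n}. a i k * b j k * ((x i + y j) / 2))" if k: "k < n" for k
  proof -
    have "(\<Sum>i<n. \<Sum>j<n. a i k * b j k * ((x i + y j) / 2))
      = (\<Sum>i<n. a i k * x i / 2 * (\<Sum>j<n. b j k) + a i k * (\<Sum>j<n. b j k * y j / 2))"
    proof (intro sum.cong refl)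
      fix i
      have "(\<Sum>j<n. a i k * b j k * ((x i + y j) / 2)) =
          (\<Sum>j<n. a i k * x i / 2 * b j k + a i k * (b j k * y j / 2))"
        by (intro sum.cong refl) (simp add: field_simps)
      then show "(\<Sum>j<n. a i k * b j k * ((x i + y j) / 2)) =
          a i k * x i / 2 * (\<Sum>j<n. b j k) + a i k * (\<Sum>j<n. b j k * y j / 2)"
        by (simp only: sum.distrib sum_distrib_left)
    qed
    also have "\<dots> = (\<Sum>i<n. a i k * x i / 2) + (\<Sum>j<n. b j k * y j / 2)"
      using bsum(2)[OF k] asum(2)[OF k] by (simp add: sum.distrib sum_distrib_right[symmetric])
    also have "\<dots> = m k"
      unfolding mean_eigenvalue[OF U V W M k] by (simp add: a_def b_def sum_divide_distrib add_divide_distrib)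
    finally show ?thesis by (simp add: sum.cartesian_product)
  qed
  have wsum: "(\<Sum>(i, j)\<in>{..<n} \<times> {..<n}. a i k * b j k) = 1" if k: "k < n" for k
    using asum(2)[OF k] bsum(2)[OF k]
    by (simp add: sum.cartesian_product[symmetric] sum_distrib_left[symmetric])
  have jensen: "(\<Sum>(i, j)\<in>{..<n} \<times> {..<n}. a i k * b j k * ln ((x i + y j) / 2)) \<le> ln (m k)"
    if k: "k < n" for k
    unfolding mk[OF k]
    using sum_ln_le_ln_sum[of "{..<n} \<times> {..<n}" "\<lambda>(i, j). a i k * b j k" "\<lambda>(i, j). (x i + y j) / 2"]
      wsum[OF k] nonneg x y by (auto simp: case_prod_unfold add_pos_pos)
  have "pos_def n (spectral_form n W m)"
    unfolding M[symmetric] using x y by (intro pos_def_mean) (simp_all add: pos_def_spectral_form_iff U V)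
  then have mpos: "0 < m k" if "k < n" for k
    using that by (simp add: pos_def_spectral_form_iff[OF W])
  define C where "C i j = (\<Sum>k<n. a i k * b j k)" for i j
  have C: "0 \<le> C i j" for i j
    using nonneg by (auto simp: C_def intro!: sum_nonneg)
  have row: "(\<Sum>j<n. C i j) = 1" if "i < n" for i
    unfolding C_def using that asum bsum by (subst sum.swap) (simp add: sum_distrib_left[symmetric])
  have col: "(\<Sum>i<n. C i j) = 1" if "j < n" for j
    unfolding C_def using that asum bsum by (subst sum.swap) (simp add: sum_distrib_right[symmetric])
  have "(\<Sum>i<n. \<Sum>j<n. C i j * ln ((x i + y j) / 2)) =
      (\<Sum>p\<in>{..<n} \<times> {..<n}. \<Sum>k<n. a (fst p) k * b (snd p) k * ln ((x (fst p) + y (snd p)) / 2))"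
    unfolding C_def sum_distrib_right
    by (subst (2) sum.cartesian_product) (simp only: case_prod_unfold fst_conv snd_conv)
  also have "\<dots> = (\<Sum>k<n. \<Sum>(i, j)\<in>{..<n} \<times> {..<n}. a i k * b j k * ln ((x i + y j) / 2))"
    by (subst sum.swap) (simp add: case_prod_unfold)
  also have "\<dots> \<le> (\<Sum>k<n. ln (m k))"
    using jensen by (intro sum_mono) auto
  also have "\<dots> = ln_det ((1/2) \<cdot>\<^sub>m (?X + ?Y))"
    unfolding M using mpos by (simp add: ln_det_spectral_form[OF W])
  finally have main: "(\<Sum>i<n. \<Sum>j<n. C i j * ln ((x i + y j) / 2)) \<le> ln_det ((1/2) \<cdot>\<^sub>m (?X + ?Y))" .
  \<comment> \<open>Since C has marginals 1, the terms with a single eigenvalue are reproduced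
    exactly; only the term of the mean is an estimate.\<close>
  have "(\<Sum>i<n. \<Sum>j<n. C i j * ln (x i)) = (\<Sum>i<n. ln (x i))"
    using row by (simp add: sum_distrib_right[symmetric])
  moreover have "(\<Sum>i<n. \<Sum>j<n. C i j * ln (y j)) = (\<Sum>j<n. ln (y j))"
    using col by (subst sum.swap) (simp add: sum_distrib_right[symmetric])
  moreover have "(\<Sum>i<n. \<Sum>j<n. C i j * ln_gap (x i) (y j)) =
     (\<Sum>i<n. \<Sum>j<n. C i j * ln ((x i + y j) / 2)) - (\<Sum>i<n. \<Sum>j<n. C i j * ln (x i)) / 2
      - (\<Sum>i<n. \<Sum>j<n. C i j * ln (y j)) / 2"
    by (simp add: ln_gap_def algebra_simps sum_subtractf sum_divide_distrib sum.distrib)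
  ultimately have "(\<Sum>i<n. \<Sum>j<n. C i j * ln_gap (x i) (y j)) \<le> ln_det_gap ?X ?Y"
    using main x y by (simp add: ln_det_gap_def ln_det_spectral_form[OF U] ln_det_spectral_form[OF V])
  then show ?thesis using that C row col by blast
qed

lemma ln_det_gap_nonneg:
  assumes "pos_def n A" "pos_def n B"
  shows "0 \<le> ln_det_gap A B"
proof -
  obtain U x where U: "unitary_mat n U" "A = spectral_form n U x" and x: "\<And>i. i < n \<Longrightarrow> 0 < x i"
    using pos_def_spectral_form[OF assms(1)] by blast
  obtain V y where V: "unitary_mat n V" "B = spectral_form n V y" and y: "\<And>i. i < n \<Longrightarrow> 0 < y i"
    using pos_def_spectral_form[OF assms(2)] by blast
  obtain C where C: "\<And>i j. 0 \<le> (C i j :: real)"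
    and le: "(\<Sum>i<n. \<Sum>j<n. C i j * ln_gap (x i) (y j)) \<le> ln_det_gap A B"
    unfolding U(2) V(2) by (rule ln_det_gap_ge_coupling[OF U(1) V(1), of x y]) (use x y in auto)
  have "0 \<le> (\<Sum>i<n. \<Sum>j<n. C i j * ln_gap (x i) (y j))"
    using C x y by (auto intro!: sum_nonneg mult_nonneg_nonneg ln_gap_nonneg)
  then show ?thesis using le by linarith
qed

text \<open>The identity is diagonal in every eigenbasis, so the gap is an exact sum rather than a
  bound. This is the gain from normalizing one argument to 1.\<close>

lemma ln_det_gap_one:
  assumes U: "unitary_mat n U" and x: "\<And>i. i < n \<Longrightarrow> 0 < x i"
  shows "ln_det_gap (1\<^sub>m n) (spectral_form n U x) = (\<Sum>i<n. ln_gap 1 (x i))"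
proof -
  have one: "1\<^sub>m n = spectral_form n U (\<lambda>_. 1)"
    by (rule eq_matI) (simp_all add: spectral_form_const[OF U])
  have half: "(1/2 :: complex) = complex_of_real (1/2)" by simp
  have "(1/2) \<cdot>\<^sub>m (1\<^sub>m n + spectral_form n U x) = spectral_form n U (\<lambda>i. (1 + x i) / 2)"
    unfolding half one spectral_form_add[OF U] spectral_form_smult[OF U] by simp
  moreover have "ln_det (1\<^sub>m n) = 0" by (simp add: ln_det_def)
  ultimately show ?thesis
    using x by (simp add: ln_det_gap_def ln_det_spectral_form[OF U] add_pos_pos ln_gap_def
        sum_subtractf sum_divide_distrib)
qed

text \<open>The two gaps at 1 are exact; only the gap between A and B is estimated, and it stands on
  the larger side, where a lower bound is what counts. The marginals of C spread both exact sums
  over pairs (i, j), and the scalar inequality applies to each pair.\<close>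

lemma ln_det_gap_triangle_one:
  assumes A: "pos_def n A" and B: "pos_def n B" and s: "0 < s"
  shows "ln_det_gap (1\<^sub>m n) B \<le> (1 + s) * ln_det_gap (1\<^sub>m n) A + (1 + 1/s) * ln_det_gap A B"
proof -
  obtain U x where U: "unitary_mat n U" "A = spectral_form n U x" and x: "\<And>i. i < n \<Longrightarrow> 0 < x i"
    using pos_def_spectral_form[OF A] by blast
  obtain V y where V: "unitary_mat n V" "B = spectral_form n V y" and y: "\<And>i. i < n \<Longrightarrow> 0 < y i"
    using pos_def_spectral_form[OF B] by blast
  obtain C where C: "\<And>i j. 0 \<le> (C i j :: real)"
    and row: "\<And>i. i < n \<Longrightarrow> (\<Sum>j<n. C i j) = 1" and col: "\<And>j. j < n \<Longrightarrow> (\<Sum>i<n. C i j) = 1"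
    and le: "(\<Sum>i<n. \<Sum>j<n. C i j * ln_gap (x i) (y j)) \<le> ln_det_gap A B"
    unfolding U(2) V(2) by (rule ln_det_gap_ge_coupling[OF U(1) V(1), of x y]) (use x y in auto)
  have "ln_det_gap (1\<^sub>m n) B = (\<Sum>j<n. (\<Sum>i<n. C i j) * ln_gap 1 (y j))"
    unfolding V(2) using y col by (simp add: ln_det_gap_one[OF V(1)])
  also have "\<dots> = (\<Sum>i<n. \<Sum>j<n. C i j * ln_gap 1 (y j))"
    by (subst sum.swap) (simp add: sum_distrib_right)
  also have "\<dots> \<le> (\<Sum>i<n. \<Sum>j<n. C i j * ((1 + s) * ln_gap 1 (x i) + (1 + 1/s) * ln_gap (x i) (y j)))"
    using C x y s by (intro sum_mono mult_left_mono ln_gap_triangle) auto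
  also have "\<dots> = (1 + s) * (\<Sum>i<n. (\<Sum>j<n. C i j) * ln_gap 1 (x i))
      + (1 + 1/s) * (\<Sum>i<n. \<Sum>j<n. C i j * ln_gap (x i) (y j))"
    by (simp add: distrib_left sum.distrib sum_distrib_left sum_distrib_right mult_ac)
  also have "(\<Sum>i<n. (\<Sum>j<n. C i j) * ln_gap 1 (x i)) = ln_det_gap (1\<^sub>m n) A"
    unfolding U(2) using x row by (simp add: ln_det_gap_one[OF U(1)])
  finally show ?thesis
    using mult_left_mono[OF le, of "1 + 1/s"] s by simp
qed

text \<open>The correction does not depend on A. In a gap it occurs with coefficients 1, -1/2 and
  -1/2 and cancels, which makes the gap invariant.\<close>

lemma ln_det_congruence:
  assumes S: "S \<in> carrier_mat n n" "Im (det S) = 0" "det S \<noteq> 0" and A: "pos_def n A"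
  shows "ln_det (S * A * S) = ln ((Re (det S))\<^sup>2) + ln_det A"
proof -
  obtain U x where U: "unitary_mat n U" "A = spectral_form n U x" and x: "\<And>i. i < n \<Longrightarrow> 0 < x i"
    using pos_def_spectral_form[OF A] by blast
  have Ac: "A \<in> carrier_mat n n" using U spectral_form_carrier by blast
  have dA: "det A = complex_of_real (\<Prod>i<n. x i)" "0 < (\<Prod>i<n. x i)"
    using U x by (auto simp: spectral_form_det intro!: prod_pos)
  have dS: "det S = complex_of_real (Re (det S))" "Re (det S) \<noteq> 0"
    using S by (auto simp: complex_eq_iff)
  have "det (S * A * S) = det S * det A * det S"
    using S(1) Ac by (simp add: det_mult[of _ n] mult_carrier_mat[of _ n n _ n])
  also have "\<dots> = complex_of_real ((Re (det S))\<^sup>2 * (\<Prod>i<n. x i))"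
    by (subst (1 2) dS(1)) (simp add: dA power2_eq_square mult_ac del: of_real_prod)
  finally have "ln_det (S * A * S) = ln ((Re (det S))\<^sup>2 * (\<Prod>i<n. x i))"
    unfolding ln_det_def by (metis Re_complex_of_real)
  also have "\<dots> = ln ((Re (det S))\<^sup>2) + ln (\<Prod>i<n. x i)"
    using dA(2) dS(2) by (intro ln_mult_pos) simp_all
  finally show ?thesis unfolding ln_det_def dA(1) Re_complex_of_real .
qed

theorem ln_det_gap_triangle:
  assumes X: "pos_def n X" and Y: "pos_def n Y" and Z: "pos_def n Z" and s: "0 < s"
  shows "ln_det_gap X Y \<le> (1 + s) * ln_det_gap X Z + (1 + 1/s) * ln_det_gap Z Y"
proof -
  obtain U x where U: "unitary_mat n U" "X = spectral_form n U x" and x: "\<And>i. i < n \<Longrightarrow> 0 < x i"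
    using pos_def_spectral_form[OF X] by blast
  \<comment> \<open>S is the inverse square root of X: it is Hermitian, so \<open>S * A * S\<close>
    is a congruence, and it takes X to 1.\<close>
  define S where "S = spectral_form n U (\<lambda>i. 1 / sqrt (x i))"
  have Sc: "S \<in> carrier_mat n n" using U by (simp add: S_def spectral_form_carrier)
  have Sadj: "mat_adjoint S = S" by (simp add: S_def spectral_form_adjoint[OF U(1)])
  have "0 < (\<Prod>i<n. 1 / sqrt (x i))" using x by (auto intro!: prod_pos)
  then have Sdet: "Im (det S) = 0" "det S \<noteq> 0"
    unfolding S_def spectral_form_det[OF U(1)] of_real_eq_0_iff by (simp_all only: Im_complex_of_real less_irrefl)
  have cong: "pos_def n (S * A * S)" if "pos_def n A" for A
  proof -
    have "A \<in> carrier_mat n n" using that by (simp add: pos_def_def psd_mat_def)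
    then show ?thesis
      using that psd_mat_congruence[of n A S n] Sc Sdet Sadj
      by (simp add: pos_def_def det_mult[of _ n] mult_carrier_mat[of _ n n _ n])
  qed
  have gap: "ln_det_gap (S * A * S) (S * B * S) = ln_det_gap A B" if A: "pos_def n A" and B: "pos_def n B" for A B
  proof -
    have c: "A \<in> carrier_mat n n" "B \<in> carrier_mat n n" using A B by (auto simp: pos_def_def psd_mat_def)
    have "(1/2) \<cdot>\<^sub>m (S * A * S + S * B * S) = S * ((1/2) \<cdot>\<^sub>m (A + B)) * S"
      using Sc c by (simp add: mult_smult_distrib[of _ n n _ n] mult_smult_assoc_mat[of _ n n _ n]
        mult_add_distrib_mat[of _ n n _ n] add_mult_distrib_mat[of _ n n _ _ n] mult_carrier_mat[of _ n n _ n])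
    moreover have "pos_def n ((1/2) \<cdot>\<^sub>m (A + B))"
      using A B by (rule pos_def_mean)
    ultimately show ?thesis
      by (simp add: ln_det_gap_def ln_det_congruence[OF Sc Sdet] A B add_divide_distrib)
  qed
  have "S * X * S = spectral_form n U (\<lambda>_. 1)"
    unfolding S_def U(2) spectral_form_mult[OF U(1)]
    using x by (intro spectral_form_cong) (fastforce simp: field_simps less_imp_le)
  also have "\<dots> = 1\<^sub>m n"
    by (rule eq_matI) (simp_all add: spectral_form_const[OF U(1)])
  finally show ?thesis
    using ln_det_gap_triangle_one[OF cong[OF Z] cong[OF Y] s]
      gap[OF X Y] gap[OF X Z] gap[OF Z Y] by simp
qed

section \<open>From the log-determinant gap to the quantum Jensen-Shannon divergence\<close>

text \<open>A nonincreasing function that tends to 0 is nonnegative. The point 0 is attached by a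
  one-sided limit only, because for singular matrices the derivative may blow up there.\<close>

lemma antimono_limit_nonneg:
  fixes f g :: "real \<Rightarrow> real"
  assumes deriv: "\<And>t. 0 < t \<Longrightarrow> (f has_real_derivative g t) (at t)"
    and g: "\<And>t. 0 < t \<Longrightarrow> g t \<le> 0"
    and top: "(f \<longlongrightarrow> 0) at_top" and zero: "(f \<longlongrightarrow> f 0) (at_right 0)"
  shows "0 \<le> f 0"
proof -
  have "0 \<le> f t" if t: "0 < t" for t
  proof (rule tendsto_upperbound[OF top _ trivial_limit_at_top_linorder])
    have "f u \<le> f t" if "t \<le> u" for u
    proof (rule DERIV_nonpos_imp_nonincreasing[OF that])
      fix v assume "t \<le> v" "v \<le> u"
      then have "0 < v" using t by simp
      then show "\<exists>d. (f has_real_derivative d) (at v) \<and> d \<le> 0" using deriv g by blast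
    qed
    then show "\<forall>\<^sub>F u in at_top. f u \<le> f t"
      using eventually_ge_at_top[of t] by (rule eventually_mono[rotated]) auto
  qed
  then show ?thesis
    by (intro tendsto_lowerbound[OF zero]) (auto intro: eventually_mono[OF eventually_at_right_less])
qed

text \<open>The subtracted terms are the first-order expansion of (x + t) ln (x + t) in x. Using ln
  y \<le> y - 1 at y = (x + t) / t and at its reciprocal puts the remainder between 0 and
  \<open>x\<^sup>2 / t\<close>.\<close>

lemma xlnx_shift_at_top:
  assumes "0 \<le> (x :: real)"
  shows "((\<lambda>t. (x + t) * ln (x + t) - t * ln t - x * (ln t + 1)) \<longlongrightarrow> 0) at_top"
proof (rule tendsto_sandwich)
  have bounds: "0 \<le> (x + t) * ln (x + t) - t * ln t - x * (ln t + 1)"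
    "(x + t) * ln (x + t) - t * ln t - x * (ln t + 1) \<le> x\<^sup>2 / t" if t: "0 < t" for t
  proof -
    have split: "(x + t) * ln (x + t) - t * ln t - x * (ln t + 1) = (x + t) * ln ((x + t) / t) - x"
      using assms t by (simp add: ln_div algebra_simps)
    have "(x + t) * ln ((x + t) / t) \<le> (x + t) * ((x + t) / t - 1)"
      using assms t by (intro mult_left_mono ln_le_minus_one) (auto simp: add_nonneg_pos)
    then show "(x + t) * ln (x + t) - t * ln t - x * (ln t + 1) \<le> x\<^sup>2 / t"
      unfolding split using t by (simp add: field_simps power2_eq_square)
    have "- ln ((x + t) / t) = ln (t / (x + t))"
      using assms t by (simp add: ln_div add_nonneg_pos)
    also have "\<dots> \<le> t / (x + t) - 1"
      using assms t by (intro ln_le_minus_one) (auto simp: add_nonneg_pos)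
    finally have "(x + t) * (1 - t / (x + t)) \<le> (x + t) * ln ((x + t) / t)"
      using assms t by (intro mult_left_mono) auto
    moreover have "(x + t) * (1 - t / (x + t)) = x"
      using assms t by (simp add: field_simps)
    ultimately show "0 \<le> (x + t) * ln (x + t) - t * ln t - x * (ln t + 1)"
      unfolding split by simp
  qed
  show "\<forall>\<^sub>F t in at_top. 0 \<le> (x + t) * ln (x + t) - t * ln t - x * (ln t + 1)"
    "\<forall>\<^sub>F t in at_top. (x + t) * ln (x + t) - t * ln t - x * (ln t + 1) \<le> x\<^sup>2 / t"
    using bounds by (auto intro: eventually_mono[OF eventually_gt_at_top[of 0]])
  show "((\<lambda>t. x\<^sup>2 / t) \<longlongrightarrow> 0) at_top"
    by (rule tendsto_divide_0[OF tendsto_const]) (simp add: filterlim_at_top_imp_at_infinity filterlim_ident)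
qed simp

lemma xlnx_shift_at_zero:
  assumes "0 \<le> (x :: real)"
  shows "((\<lambda>t. (x + t) * ln (x + t)) \<longlongrightarrow> x * ln x) (at_right 0)"
proof (cases "x = 0")
  case True
  \<comment> \<open>At x = 0 the limit must be 0 ln 0 = 0; continuity of ln gives nothing there, so
    t is replaced by its inverse and ln y / y tends to 0.\<close>
  have "((\<lambda>t. t * ln t) \<longlongrightarrow> 0) (at_right (0::real))"
  proof (rule Lim_transform_eventually)
    have "((\<lambda>t. - (ln (inverse t) / inverse t)) \<longlongrightarrow> - 0) (at_right (0::real))"
      by (intro tendsto_minus filterlim_compose[OF ln_x_over_x_tendsto_0 filterlim_inverse_at_top_right])
    then show "((\<lambda>t. - (ln (inverse t) / inverse t)) \<longlongrightarrow> 0) (at_right (0::real))" by simp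
    show "\<forall>\<^sub>F t in at_right (0::real). - (ln (inverse t) / inverse t) = t * ln t"
      by (rule eventually_mono[OF eventually_at_right_less]) (simp add: ln_inverse divide_inverse)
  qed
  then show ?thesis using True by simp
next
  case False
  then have "((\<lambda>t. (x + t) * ln (x + t)) \<longlongrightarrow> (x + 0) * ln (x + 0)) (at_right 0)"
    by (intro tendsto_intros) auto
  then show ?thesis by simp
qed

section \<open>Entropy along the path A + t\<close>

definition shift :: "real \<Rightarrow> complex mat \<Rightarrow> complex mat" where
  "shift t A = A + complex_of_real t \<cdot>\<^sub>m 1\<^sub>m (dim_row A)"

lemma shift_spectral_form:
  assumes U: "unitary_mat n U"
  shows "shift t (spectral_form n U d) = spectral_form n U (\<lambda>i. d i + t)"
  using spectral_form_carrier[OF U, of d]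
  by (simp add: shift_def spectral_form_const[OF U, symmetric] spectral_form_add[OF U])

lemma shift_mean:
  assumes "A \<in> carrier_mat n n" "B \<in> carrier_mat n n"
  shows "(1/2) \<cdot>\<^sub>m (shift t A + shift t B) = shift t ((1/2) \<cdot>\<^sub>m (A + B))"
  using assms by (intro eq_matI) (auto simp: shift_def field_simps)

lemma pos_def_shift:
  assumes A: "psd_mat n A" and t: "0 < t"
  shows "pos_def n (shift t A)"
proof -
  obtain U x where U: "unitary_mat n U" "A = spectral_form n U x" and x: "\<And>i. i < n \<Longrightarrow> 0 \<le> x i"
    using psd_spectral_form[OF A] by blast
  show ?thesis
    unfolding U(2) shift_spectral_form[OF U(1)] pos_def_spectral_form_iff[OF U(1)]
    using x t by (auto intro: add_nonneg_pos)
qed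

text \<open>The sum of (d + t) ln (d + t) over the eigenvalues has derivative ln det (A + t) + n;
  the constants n cancel with weights 1/2, 1/2 and -1.\<close>

lemma qjsd_shift:
  assumes A: "psd_mat n A" and B: "psd_mat n B"
  defines "q \<equiv> \<lambda>t. ln 2 * qjsd (shift t A) (shift t B)"
  shows "0 < t \<Longrightarrow> (q has_real_derivative - ln_det_gap (shift t A) (shift t B)) (at t)"
    and "(q \<longlongrightarrow> 0) at_top" and "(q \<longlongrightarrow> q 0) (at_right 0)"
    and "q 0 = ln 2 * qjsd A B"
proof -
  obtain U x where U: "unitary_mat n U" "A = spectral_form n U x" and x: "\<And>i. i < n \<Longrightarrow> 0 \<le> x i"
    using psd_spectral_form[OF A] by blast
  obtain V y where V: "unitary_mat n V" "B = spectral_form n V y" and y: "\<And>i. i < n \<Longrightarrow> 0 \<le> y i"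
    using psd_spectral_form[OF B] by blast
  obtain W m where W: "unitary_mat n W" and M: "(1/2) \<cdot>\<^sub>m (A + B) = spectral_form n W m"
    and m: "\<And>i. i < n \<Longrightarrow> 0 \<le> m i"
    using psd_spectral_form[OF psd_mat_mean[OF A B]] by blast
  have c: "A \<in> carrier_mat n n" "B \<in> carrier_mat n n"
    using A B by (auto simp: psd_mat_def)
  have "complex_of_real (\<Sum>i<n. m i) = complex_of_real (((\<Sum>i<n. x i) + (\<Sum>i<n. y i)) / 2)"
    using mat_trace_smult[of "A + B" n "1/2"] mat_trace_add[OF c] c
    unfolding M unfolding U(2) V(2) spectral_form_trace[OF W] spectral_form_trace[OF U(1)] spectral_form_trace[OF V(1)]
    by simp
  \<comment> \<open>Linearity of the trace makes the divergent terms with ln t cancel as t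
    grows.\<close>
  then have tr: "(\<Sum>i<n. m i) = ((\<Sum>i<n. x i) + (\<Sum>i<n. y i)) / 2"
    unfolding of_real_eq_iff .
  define h where "h d t = (\<Sum>i<n. (d i + t) * ln (d i + t))" for d :: "nat \<Rightarrow> real" and t
  have q: "q = (\<lambda>t. h x t / 2 + h y t / 2 - h m t)"
  proof
    fix t
    have "qjsd (shift t A) (shift t B) = vn_entropy (shift t (spectral_form n W m))
        - vn_entropy (shift t A) / 2 - vn_entropy (shift t B) / 2"
      by (simp add: qjsd_def shift_mean[OF c] M)
    also have "\<dots> = (h x t / 2 + h y t / 2 - h m t) / ln 2"
      unfolding U(2) V(2) shift_spectral_form[OF U(1)] shift_spectral_form[OF V(1)] shift_spectral_form[OF W]
        vn_entropy_spectral_form[OF U(1)] vn_entropy_spectral_form[OF V(1)] vn_entropy_spectral_form[OF W]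
      by (simp add: h_def diff_divide_distrib add_divide_distrib)
    finally show "q t = h x t / 2 + h y t / 2 - h m t"
      by (simp add: q_def)
  qed
  have h_deriv: "(h d has_real_derivative (\<Sum>i<n. ln (d i + t)) + n) (at t)"
    if "0 < t" "\<And>i. i < n \<Longrightarrow> 0 \<le> d i" for d t
  proof -
    have "((\<lambda>t. (d i + t) * ln (d i + t)) has_real_derivative ln (d i + t) + 1) (at t)"
      if "i < n" for i
    proof -
      have "0 < d i + t" using \<open>0 < t\<close> \<open>\<And>i. i < n \<Longrightarrow> 0 \<le> d i\<close>[OF that] by simp
      then show ?thesis by (auto intro!: derivative_eq_intros)
    qed
    then have "(h d has_real_derivative (\<Sum>i<n. ln (d i + t) + 1)) (at t)"
      unfolding h_def by (intro DERIV_sum) simp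
    then show ?thesis by (simp add: sum.distrib)
  qed
  show "(q has_real_derivative - ln_det_gap (shift t A) (shift t B)) (at t)" if t: "0 < t"
  proof -
    have "ln_det_gap (shift t A) (shift t B) = (\<Sum>i<n. ln (m i + t)) - (\<Sum>i<n. ln (x i + t)) / 2 - (\<Sum>i<n. ln (y i + t)) / 2"
      unfolding ln_det_gap_def shift_mean[OF c] M
      unfolding U(2) V(2) shift_spectral_form[OF U(1)] shift_spectral_form[OF V(1)] shift_spectral_form[OF W]
      using x y m t
      by (simp add: ln_det_spectral_form[OF U(1)] ln_det_spectral_form[OF V(1)] ln_det_spectral_form[OF W] add_nonneg_pos)
    then show ?thesis
      unfolding q using h_deriv[OF t, of x] h_deriv[OF t, of y] h_deriv[OF t, of m] x y m
      by (auto intro!: derivative_eq_intros simp: field_simps)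
  qed
  have h_top: "((\<lambda>t. h d t - n * (t * ln t) - (\<Sum>i<n. d i) * (ln t + 1)) \<longlongrightarrow> 0) at_top"
    if "\<And>i. i < n \<Longrightarrow> 0 \<le> d i" for d
  proof -
    have "((\<lambda>t. \<Sum>i<n. (d i + t) * ln (d i + t) - t * ln t - d i * (ln t + 1)) \<longlongrightarrow> (\<Sum>i<n. 0)) at_top"
      by (intro tendsto_sum xlnx_shift_at_top) (use that in auto)
    then show ?thesis by (simp add: h_def sum_subtractf sum_distrib_right)
  qed
  have "((\<lambda>t. (h x t - n * (t * ln t) - (\<Sum>i<n. x i) * (ln t + 1)) / 2
      + (h y t - n * (t * ln t) - (\<Sum>i<n. y i) * (ln t + 1)) / 2
      - (h m t - n * (t * ln t) - (\<Sum>i<n. m i) * (ln t + 1))) \<longlongrightarrow> 0 / 2 + 0 / 2 - 0) at_top"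
    by (intro tendsto_intros h_top x y m) auto
  moreover have "(\<lambda>t. (h x t - n * (t * ln t) - (\<Sum>i<n. x i) * (ln t + 1)) / 2
      + (h y t - n * (t * ln t) - (\<Sum>i<n. y i) * (ln t + 1)) / 2
      - (h m t - n * (t * ln t) - (\<Sum>i<n. m i) * (ln t + 1))) = q"
    unfolding q tr by (rule ext) (simp add: field_simps)
  ultimately show "(q \<longlongrightarrow> 0) at_top" by simp
  have h_zero: "(h d \<longlongrightarrow> h d 0) (at_right 0)" if "\<And>i. i < n \<Longrightarrow> 0 \<le> d i" for d
    unfolding h_def using that by (intro tendsto_sum) (simp add: xlnx_shift_at_zero)
  show "(q \<longlongrightarrow> q 0) (at_right 0)"
    unfolding q by (intro tendsto_intros h_zero x y m) auto
  have "shift 0 A = A" "shift 0 B = B"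
    using c by (auto simp: shift_def intro!: eq_matI)
  then show "q 0 = ln 2 * qjsd A B" by (simp add: q_def)
qed

section \<open>Inequalities for the gap carried over to the divergence\<close>

lemma qjsd_nonneg:
  assumes A: "psd_mat n A" and B: "psd_mat n B"
  shows "0 \<le> qjsd A B"
proof -
  have "0 \<le> ln 2 * qjsd (shift 0 A) (shift 0 B)"
    by (rule antimono_limit_nonneg[OF qjsd_shift(1)[OF A B] _ qjsd_shift(2,3)[OF A B]])
      (use ln_det_gap_nonneg pos_def_shift A B in \<open>force\<close>)+
  then show ?thesis using qjsd_shift(4)[OF A B] by (simp add: zero_le_mult_iff)
qed

lemma qjsd_weighted_triangle:
  assumes A: "psd_mat n A" and B: "psd_mat n B" and C: "psd_mat n C" and s: "0 < s"
  shows "qjsd A B \<le> (1 + s) * qjsd A C + (1 + 1/s) * qjsd C B"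
proof -
  define q where "q X Y t = ln 2 * qjsd (shift t X) (shift t Y)" for X Y t
  note qs = qjsd_shift[where n = n, folded q_def]
  define f where "f t = (1 + s) * q A C t + (1 + 1/s) * q C B t - q A B t" for t
  define g where "g t = (1 + s) * (- ln_det_gap (shift t A) (shift t C))
      + (1 + 1/s) * (- ln_det_gap (shift t C) (shift t B)) - (- ln_det_gap (shift t A) (shift t B))" for t
  have "0 \<le> f 0"
  proof (rule antimono_limit_nonneg)
    fix t :: real assume t: "0 < t"
    show "(f has_real_derivative g t) (at t)"
      unfolding f_def g_def
      by (intro DERIV_add DERIV_diff DERIV_cmult qs(1) A B C t)
    show "g t \<le> 0"
      using ln_det_gap_triangle[OF pos_def_shift[OF A t] pos_def_shift[OF B t] pos_def_shift[OF C t] s]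
      by (simp add: g_def)
  next
    have "(f \<longlongrightarrow> (1 + s) * 0 + (1 + 1/s) * 0 - 0) at_top"
      unfolding f_def by (intro tendsto_intros qs(2) A B C)
    then show "(f \<longlongrightarrow> 0) at_top" by simp
    show "(f \<longlongrightarrow> f 0) (at_right 0)"
      unfolding f_def by (intro tendsto_intros qs(3) A B C)
  qed
  then have "0 \<le> ln 2 * ((1 + s) * qjsd A C + (1 + 1/s) * qjsd C B - qjsd A B)"
    using qs(4)[OF A B] qs(4)[OF A C] qs(4)[OF C B] by (simp add: f_def algebra_simps)
  then show ?thesis by (simp add: zero_le_mult_iff)
qed

lemma sqrt_triangle_of_weighted:
  fixes a b c :: real
  assumes b: "0 \<le> b" and c: "0 \<le> c"
    and le: "\<And>s. 0 < s \<Longrightarrow> a \<le> (1 + s) * b + (1 + 1/s) * c"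
  shows "sqrt a \<le> sqrt b + sqrt c"
proof (rule field_le_epsilon)
  fix e :: real assume e: "0 < e"
  \<comment> \<open>The optimal weight is the ratio of the two roots. Padding each by e / 2 keeps
    the ratio defined when one of the roots is 0.\<close>
  define p q where "p = sqrt b + e / 2" and "q = sqrt c + e / 2"
  have pq: "0 < p" "0 < q" "b \<le> p\<^sup>2" "c \<le> q\<^sup>2"
    using b c e by (auto simp: p_def q_def add_nonneg_pos real_le_rsqrt intro!: sqrt_le_D)
  have "a \<le> (1 + q / p) * b + (1 + 1 / (q / p)) * c"
    using le[of "q / p"] pq by simp
  also have "\<dots> \<le> (1 + q / p) * p\<^sup>2 + (1 + 1 / (q / p)) * q\<^sup>2"
    using pq by (intro add_mono mult_left_mono) (auto intro!: add_nonneg_nonneg)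
  also have "\<dots> = (p + q)\<^sup>2"
    using pq by (simp add: field_simps power2_eq_square)
  finally have "sqrt a \<le> p + q" using pq by (intro real_le_lsqrt) auto
  then show "sqrt a \<le> sqrt b + sqrt c + e" by (simp add: p_def q_def)
qed

theorem transmission_dist_triangle:
  assumes "psd_mat n A" "psd_mat n B" "psd_mat n C"
  shows "transmission_dist A B \<le> transmission_dist A C + transmission_dist C B"
  unfolding transmission_dist_def
  by (rule sqrt_triangle_of_weighted) (use assms qjsd_nonneg qjsd_weighted_triangle in blast)+

section \<open>Duality and the Schwarz inequality for quantum operations\<close>

lemma sum_nat_pair:
  fixes f :: "nat \<Rightarrow> 'a :: comm_monoid_add"
  shows "(\<Sum>r<n * k. f r) = (\<Sum>i<n. \<Sum>a<k. f (i * k + a))"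
proof -
  have "(\<Sum>r<n * k. f r) = (\<Sum>i<n. sum f {i * k..<i * k + k})"
    by (rule sum.nat_group[symmetric])
  also have "\<dots> = (\<Sum>i<n. \<Sum>a<k. f (i * k + a))"
  proof (rule sum.cong[OF refl])
    fix i
    show "sum f {i * k..<i * k + k} = (\<Sum>a<k. f (i * k + a))"
      using sum.shift_bounds_nat_ivl[of f 0 "i * k" k] by (simp add: atLeast0LessThan add.commute)
  qed
  finally show ?thesis .
qed

lemma mat_trace_triple:
  assumes "A \<in> carrier_mat m n" "B \<in> carrier_mat m m" "C \<in> carrier_mat m n"
  shows "mat_trace (mat_adjoint A * B * C) =
    (\<Sum>k<n. \<Sum>i<m. \<Sum>j<m. cnj (A $$ (i, k)) * B $$ (i, j) * C $$ (j, k))"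
proof -
  have "mat_trace (mat_adjoint A * B * C) =
      (\<Sum>k<n. \<Sum>j<m. \<Sum>i<m. cnj (A $$ (i, k)) * B $$ (i, j) * C $$ (j, k))"
    using assms by (subst mat_trace_mult[of _ n m])
      (auto simp: scalar_prod_def atLeast0LessThan sum_distrib_right mult_carrier_mat[of _ n m _ m] mat_adjoint_carrier
        intro!: sum.cong)
  also have "\<dots> = (\<Sum>k<n. \<Sum>i<m. \<Sum>j<m. cnj (A $$ (i, k)) * B $$ (i, j) * C $$ (j, k))"
    by (intro sum.cong refl sum.swap)
  finally show ?thesis .
qed

text \<open>The blocks are interleaved, not stacked: row i of block a becomes row i * k + a,
  matching the convention of \<open>ancilla_block\<close>.\<close>

definition block_column :: "nat \<Rightarrow> nat \<Rightarrow> (nat \<Rightarrow> complex mat) \<Rightarrow> complex mat" where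
  "block_column n k W = mat (n * k) n (\<lambda>(r, c). W (r mod k) $$ (r div k, c))"

lemma block_column_carrier: "block_column n k W \<in> carrier_mat (n * k) n"
  by (simp add: block_column_def)

lemma index_block_column:
  assumes "i < n" "a < k" "c < n"
  shows "block_column n k W $$ (i * k + a, c) = W a $$ (i, c)"
  using assms nat_pair_index_less[of i n a k] by (simp add: block_column_def)

lemma ancilla_block_congruence:
  fixes k :: nat
  assumes A: "A \<in> carrier_mat n n" and W: "\<And>a. a < k \<Longrightarrow> W a \<in> carrier_mat n n" and ab: "a < k" "b < k"
  shows "ancilla_block n k (block_column n k W * A * mat_adjoint (block_column n k W)) a b =
    W a * A * mat_adjoint (W b)"
proof (rule eq_matI)
  let ?B = "block_column n k W"
  have B: "?B \<in> carrier_mat (n * k) n" by (rule block_column_carrier)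
  note Wa = W[OF ab(1)] W[OF ab(2)]
  fix i j assume "i < dim_row (W a * A * mat_adjoint (W b))" "j < dim_col (W a * A * mat_adjoint (W b))"
  then have ij: "i < n" "j < n" using Wa by auto
  have "ancilla_block n k (?B * A * mat_adjoint ?B) a b $$ (i, j) = (?B * A * mat_adjoint ?B) $$ (i * k + a, j * k + b)"
    using ij by (simp add: ancilla_block_def)
  also have "\<dots> = (W a * A * mat_adjoint (W b)) $$ (i, j)"
    using ij ab A B Wa nat_pair_index_less[of i n a k] nat_pair_index_less[of j n b k]
    by (simp add: scalar_prod_def index_block_column)
  finally show "ancilla_block n k (?B * A * mat_adjoint ?B) a b $$ (i, j) = (W a * A * mat_adjoint (W b)) $$ (i, j)" .
qed (use W ab in \<open>auto simp: ancilla_block_def\<close>)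

text \<open>Complete positivity as it is used below: the tensor extension is applied to a positive
  block matrix with blocks \<open>W a * A * mat_adjoint (W b)\<close>, and the image is tested on
  the column of the X a.\<close>

lemma block_positivity:
  fixes k :: nat
  assumes E: "quantum_operation n \<E>" and A: "psd_mat n A"
    and W: "\<And>a. a < k \<Longrightarrow> W a \<in> carrier_mat n n" and X: "\<And>a. a < k \<Longrightarrow> X a \<in> carrier_mat n n"
  shows "0 \<le> (\<Sum>a<k. \<Sum>b<k. mat_trace (mat_adjoint (X a) * \<E> (W a * A * mat_adjoint (W b)) * X b))"
proof -
  let ?W = "block_column n k W" and ?X = "block_column n k X"
  define R where "R = ?W * A * mat_adjoint ?W"
  define T where "T = tensor_id n k \<E> R"
  have Ac: "A \<in> carrier_mat n n" using A by (simp add: psd_mat_def)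
  have "psd_mat (n * k) R" unfolding R_def by (rule psd_mat_congruence[OF A block_column_carrier])
  then have T: "psd_mat (n * k) T"
    using E by (simp add: T_def quantum_operation_def completely_positive_def)
  then have Tc: "T \<in> carrier_mat (n * k) (n * k)" by (simp add: psd_mat_def)
  have lin: "\<E> M \<in> carrier_mat n n" if "M \<in> carrier_mat n n" for M
    using E that by (simp add: quantum_operation_def linear_mat_map_def)
  have EW: "\<E> (W a * A * mat_adjoint (W b)) \<in> carrier_mat n n" if "a < k" "b < k" for a b
    using W[OF that(1)] W[OF that(2)] Ac by (intro lin) (auto intro!: mult_carrier_mat[of _ n n _ n] mat_adjoint_carrier)
  have Tij: "T $$ (i * k + a, j * k + b) = \<E> (W a * A * mat_adjoint (W b)) $$ (i, j)"
    if "i < n" "j < n" "a < k" "b < k" for i j a b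
    using that nat_pair_index_less[of i n a k] nat_pair_index_less[of j n b k]
    by (simp add: T_def tensor_id_def R_def ancilla_block_congruence[OF Ac W])
  have "0 \<le> mat_trace (mat_adjoint ?X * T * ?X)"
    using psd_mat_congruence[OF T mat_adjoint_carrier[OF block_column_carrier]] psd_mat_trace_nonneg by fastforce
  \<comment> \<open>Large indices split into digits (i, a) and (j, b); the swaps that follow move a
    and b outward until each summand is the trace of one block.\<close>
  also have "mat_trace (mat_adjoint ?X * T * ?X) =
     (\<Sum>c<n. \<Sum>i<n. \<Sum>a<k. \<Sum>j<n. \<Sum>b<k. cnj (X a $$ (i, c)) * \<E> (W a * A * mat_adjoint (W b)) $$ (i, j) * X b $$ (j, c))"
    by (simp add: mat_trace_triple[OF block_column_carrier Tc block_column_carrier] sum_nat_pair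
        index_block_column Tij)
  also have "\<dots> = (\<Sum>c<n. \<Sum>a<k. \<Sum>i<n. \<Sum>b<k. \<Sum>j<n. cnj (X a $$ (i, c)) * \<E> (W a * A * mat_adjoint (W b)) $$ (i, j) * X b $$ (j, c))"
    by (rule sum.cong[OF refl], subst sum.swap, rule sum.cong[OF refl], rule sum.cong[OF refl], rule sum.swap)
  also have "\<dots> = (\<Sum>c<n. \<Sum>a<k. \<Sum>b<k. \<Sum>i<n. \<Sum>j<n. cnj (X a $$ (i, c)) * \<E> (W a * A * mat_adjoint (W b)) $$ (i, j) * X b $$ (j, c))"
    by (intro sum.cong refl sum.swap)
  also have "\<dots> = (\<Sum>a<k. \<Sum>b<k. \<Sum>c<n. \<Sum>i<n. \<Sum>j<n. cnj (X a $$ (i, c)) * \<E> (W a * A * mat_adjoint (W b)) $$ (i, j) * X b $$ (j, c))"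
    by (subst sum.swap, rule sum.cong[OF refl], rule sum.swap)
  also have "\<dots> = (\<Sum>a<k. \<Sum>b<k. mat_trace (mat_adjoint (X a) * \<E> (W a * A * mat_adjoint (W b)) * X b))"
    by (intro sum.cong refl mat_trace_triple[symmetric] X EW) auto
  finally show ?thesis .
qed

section \<open>Consequences of 2-positivity\<close>

lemma psd_mat_one: "psd_mat n (1\<^sub>m n)"
  using mult_adjoint_psd[of "1\<^sub>m n" n n] by simp

text \<open>The block matrix with rows (1, Y) and (\<open>mat_adjoint Y\<close>,
  \<open>mat_adjoint Y * Y\<close>) is positive, so its image is Hermitian, and the two off-diagonal
  blocks of the image are adjoint to each other.\<close>

lemma quantum_operation_adjoint:
  assumes E: "quantum_operation n \<E>" and Y: "Y \<in> carrier_mat n n"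
  shows "\<E> (mat_adjoint Y) = mat_adjoint (\<E> Y)"
proof -
  define W where "W = (\<lambda>a::nat. if a = 0 then 1\<^sub>m n else mat_adjoint Y)"
  have W: "W a \<in> carrier_mat n n" for a using Y by (simp add: W_def mat_adjoint_carrier)
  let ?W = "block_column n 2 W"
  define R where "R = ?W * 1\<^sub>m n * mat_adjoint ?W"
  define T where "T = tensor_id n 2 \<E> R"
  have "psd_mat (n * 2) R" unfolding R_def by (rule psd_mat_congruence[OF psd_mat_one block_column_carrier])
  then have T: "psd_mat (n * 2) T"
    using E by (simp add: T_def quantum_operation_def completely_positive_def)
  have lin: "\<E> M \<in> carrier_mat n n" if "M \<in> carrier_mat n n" for M
    using E that by (simp add: quantum_operation_def linear_mat_map_def)
  have Y': "mat_adjoint Y \<in> carrier_mat n n" using Y by (rule mat_adjoint_carrier)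
  have Tij: "T $$ (i * 2 + a, j * 2 + b) = \<E> (W a * 1\<^sub>m n * mat_adjoint (W b)) $$ (i, j)"
    if "i < n" "j < n" "a < 2" "b < 2" for i j a b
    using that nat_pair_index_less[of i n a 2] nat_pair_index_less[of j n b 2]
    by (simp add: T_def tensor_id_def R_def ancilla_block_congruence[OF one_carrier_mat W])
  show ?thesis
  proof (rule eq_matI)
    show "dim_row (\<E> (mat_adjoint Y)) = dim_row (mat_adjoint (\<E> Y))"
      "dim_col (\<E> (mat_adjoint Y)) = dim_col (mat_adjoint (\<E> Y))"
      using lin[OF Y] lin[OF Y'] by auto
    fix i j assume "i < dim_row (mat_adjoint (\<E> Y))" "j < dim_col (mat_adjoint (\<E> Y))"
    then have ij: "i < n" "j < n" using lin[OF Y] by auto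
    have "T $$ (i * 2 + 1, j * 2 + 0) = mat_adjoint T $$ (i * 2 + 1, j * 2 + 0)"
      by (simp only: psd_mat_hermitian[OF T])
    also have "\<dots> = cnj (T $$ (j * 2 + 0, i * 2 + 1))"
      using ij nat_pair_index_less[of i n 1 2] nat_pair_index_less[of j n 0 2] T
      by (intro index_mat_adjoint) (auto simp: psd_mat_def)
    finally have "\<E> (mat_adjoint Y) $$ (i, j) = cnj (\<E> Y $$ (j, i))"
      using Tij[OF ij, of 1 0] Tij[of j i 0 1] ij Y Y' by (simp add: W_def)
    then show "\<E> (mat_adjoint Y) $$ (i, j) = mat_adjoint (\<E> Y) $$ (i, j)"
      using ij lin[OF Y] by simp
  qed
qed

text \<open>This is \<open>\<E>\<^sup>*(X) \<E>\<^sup>*(X)\<^sup>* \<le> \<E>\<^sup>*(X X\<^sup>*)\<close> tested against A, with Z the image of X under the dual map.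
  It comes from 2-positivity of \<open>\<E>\<close> at the block matrix with rows (A, A Z) and (Z* A, Z* A Z).\<close>

lemma quantum_operation_schwarz:
  assumes E: "quantum_operation n \<E>" and A: "psd_mat n A"
    and X: "X \<in> carrier_mat n n" and Z: "Z \<in> carrier_mat n n"
    and dual: "\<And>Y. Y \<in> carrier_mat n n \<Longrightarrow> mat_trace (mat_adjoint X * \<E> Y) = mat_trace (mat_adjoint Z * Y)"
  shows "mat_trace (mat_adjoint Z * A * Z) \<le> mat_trace (mat_adjoint X * \<E> A * X)"
proof -
  have Ac: "A \<in> carrier_mat n n" using A by (simp add: psd_mat_def)
  have lin: "\<E> M \<in> carrier_mat n n" if "M \<in> carrier_mat n n" for M
    using E that by (simp add: quantum_operation_def linear_mat_map_def)
  note mc = mult_carrier_mat[of _ n n _ n]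
  note ac = mat_adjoint_carrier[OF X] mat_adjoint_carrier[OF Z]
  define W where "W = (\<lambda>a::nat. if a = 0 then 1\<^sub>m n else mat_adjoint Z)"
  \<comment> \<open>With test blocks X and -1 the four terms are the trace on the right of the
    claim, twice -z and once +z, where z is the trace on the left; the term +z uses trace
    preservation.\<close>
  define X' where "X' = (\<lambda>a::nat. if a = 0 then X else - 1\<^sub>m n)"
  have neg: "mat_adjoint (- 1\<^sub>m n :: complex mat) = - 1\<^sub>m n"
    by (rule eq_matI) auto
  let ?z = "mat_trace (mat_adjoint Z * A * Z)"
  have zz: "psd_mat n (mat_adjoint Z * A * Z)"
    using psd_mat_congruence[OF A ac(2)] by simp
  have AZ: "A * Z \<in> carrier_mat n n" "mat_adjoint Z * A \<in> carrier_mat n n" "mat_adjoint Z * A * Z \<in> carrier_mat n n"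
    using Ac Z ac by (simp_all add: mc)
  have AZa: "mat_adjoint (A * Z) = mat_adjoint Z * A"
    using Ac Z by (simp add: mat_adjoint_mult[of _ n n _ n] psd_mat_hermitian[OF A])
  have t1: "mat_trace (mat_adjoint X * \<E> (A * Z)) = ?z"
    using dual[OF AZ(1)] Ac Z ac by (simp add: assoc_mult_mat[of _ n n _ n _ n])
  have "mat_trace (\<E> (mat_adjoint Z * A) * X) = mat_trace (mat_adjoint (mat_adjoint X * \<E> (A * Z)))"
    using X ac lin[OF AZ(1)] by (simp add: mat_adjoint_mult[of _ n n _ n] AZa[symmetric]
        quantum_operation_adjoint[OF E AZ(1)])
  also have "\<dots> = cnj ?z"
    unfolding t1[symmetric] by (rule mat_trace_adjoint[of _ n]) (use lin[OF AZ(1)] ac in \<open>simp add: mc\<close>)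
  also have "\<dots> = ?z"
    using psd_mat_trace_nonneg[OF zz] by (simp add: complex_eq_iff less_eq_complex_def)
  finally have t2: "mat_trace (\<E> (mat_adjoint Z * A) * X) = ?z" .
  have t3: "mat_trace (\<E> (mat_adjoint Z * A * Z)) = ?z"
    using E AZ by (simp add: quantum_operation_def trace_preserving_def)
  have uminus: "mat_trace (- M) = - mat_trace M" if "M \<in> carrier_mat n n" for M
    using that by (auto simp: mat_trace_def sum_negf[symmetric] intro!: sum.cong)
  have "0 \<le> (\<Sum>a<2. \<Sum>b<2. mat_trace (mat_adjoint (X' a) * \<E> (W a * A * mat_adjoint (W b)) * X' b))"
    by (rule block_positivity[OF E A]) (use X ac in \<open>auto simp: W_def X'_def\<close>)
  also have "\<dots> = mat_trace (mat_adjoint X * \<E> A * X) - ?z"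
  proof -
    have "mat_trace (mat_adjoint X * \<E> (A * Z) * - 1\<^sub>m n) = - ?z"
      using ac lin[OF AZ(1)] X t1 by (simp add: uminus mc)
    moreover have "mat_trace (- 1\<^sub>m n * \<E> (mat_adjoint Z * A) * X) = - ?z"
      using ac lin[OF AZ(2)] X t2 by (simp add: uminus mc)
    moreover have "mat_trace (- 1\<^sub>m n * \<E> (mat_adjoint Z * A * Z) * - 1\<^sub>m n) = ?z"
      using lin[OF AZ(3)] t3 by (simp add: uminus mc)
    ultimately show ?thesis
      using Ac by (simp add: numeral_2_eq_2 W_def X'_def neg)
  qed
  finally show ?thesis by simp
qed

text \<open>L is determined by its values on matrix units. The trace pairs entry (i, j) with entry
  (j, i), hence the transposed index in C.\<close>

lemma linear_functional_trace:
  assumes add: "\<And>A B. A \<in> carrier_mat n n \<Longrightarrow> B \<in> carrier_mat n n \<Longrightarrow> L (A + B) = L A + L B"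
    and smult: "\<And>c A. A \<in> carrier_mat n n \<Longrightarrow> L (c \<cdot>\<^sub>m A) = c * (L A :: complex)"
  shows "\<exists>C\<in>carrier_mat n n. \<forall>Y\<in>carrier_mat n n. L Y = mat_trace (C * Y)"
proof -
  define e :: "nat \<times> nat \<Rightarrow> complex mat" where "e p = mat n n (\<lambda>q. if q = p then 1 else 0)" for p
  define C where "C = mat n n (\<lambda>(i, j). L (e (j, i)))"
  have C: "C \<in> carrier_mat n n" by (simp add: C_def)
  have "L Y = mat_trace (C * Y)" if Y: "Y \<in> carrier_mat n n" for Y
  proof -
    \<comment> \<open>Y with all entries outside S set to 0; the induction adds one entry at a
      time.\<close>
    define r where "r S = mat n n (\<lambda>q. if q \<in> S then Y $$ q else 0)" for S
    have "L (r S) = (\<Sum>p\<in>S. Y $$ p * L (e p))" if "finite S" for S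
      using that
    proof induction
      case empty
      have "r {} = 0 \<cdot>\<^sub>m 1\<^sub>m n" by (rule eq_matI) (auto simp: r_def)
      then show ?case using smult[OF one_carrier_mat, of 0] by simp
    next
      case (insert p S)
      have "r (insert p S) = r S + Y $$ p \<cdot>\<^sub>m e p"
        using insert by (intro eq_matI) (auto simp: r_def e_def)
      then have "L (r (insert p S)) = L (r S) + L (Y $$ p \<cdot>\<^sub>m e p)"
        using add[of "r S" "Y $$ p \<cdot>\<^sub>m e p"] by (simp add: r_def e_def)
      also have "L (Y $$ p \<cdot>\<^sub>m e p) = Y $$ p * L (e p)"
        by (rule smult) (simp add: e_def)
      finally show ?case using insert by simp
    qed
    from this[of "{..<n} \<times> {..<n}"]
    have "L (r ({..<n} \<times> {..<n})) = (\<Sum>p\<in>{..<n} \<times> {..<n}. Y $$ p * L (e p))" by simp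
    moreover have "r ({..<n} \<times> {..<n}) = Y" using Y by (intro eq_matI) (auto simp: r_def)
    moreover have "(\<Sum>p\<in>{..<n} \<times> {..<n}. Y $$ p * L (e p)) = (\<Sum>j<n. \<Sum>i<n. Y $$ (j, i) * L (e (j, i)))"
      by (simp add: sum.cartesian_product case_prod_unfold)
    moreover have "\<dots> = mat_trace (C * Y)"
      unfolding mat_trace_mult[OF C Y] by (subst sum.swap) (simp add: C_def mult.commute)
    ultimately show ?thesis by simp
  qed
  then show ?thesis using C by blast
qed

text \<open>Z is the image of X under the dual map of the Heisenberg picture, obtained for one X at
  a time.\<close>

lemma quantum_operation_dual:
  assumes E: "quantum_operation n \<E>" and X: "X \<in> carrier_mat n n"
  obtains Z where "Z \<in> carrier_mat n n"
    "\<And>Y. Y \<in> carrier_mat n n \<Longrightarrow> mat_trace (mat_adjoint X * \<E> Y) = mat_trace (mat_adjoint Z * Y)"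
proof -
  have lin: "\<And>A. A \<in> carrier_mat n n \<Longrightarrow> \<E> A \<in> carrier_mat n n"
    "\<And>A B. A \<in> carrier_mat n n \<Longrightarrow> B \<in> carrier_mat n n \<Longrightarrow> \<E> (A + B) = \<E> A + \<E> B"
    "\<And>c A. A \<in> carrier_mat n n \<Longrightarrow> \<E> (c \<cdot>\<^sub>m A) = c \<cdot>\<^sub>m \<E> A"
    using E by (auto simp: quantum_operation_def linear_mat_map_def)
  note X' = mat_adjoint_carrier[OF X]
  have "\<exists>C\<in>carrier_mat n n. \<forall>Y\<in>carrier_mat n n. mat_trace (mat_adjoint X * \<E> Y) = mat_trace (C * Y)"
  proof (rule linear_functional_trace[of n "\<lambda>Y. mat_trace (mat_adjoint X * \<E> Y)"])
    fix A B :: "complex mat" assume A: "A \<in> carrier_mat n n" and B: "B \<in> carrier_mat n n"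
    show "mat_trace (mat_adjoint X * \<E> (A + B)) = mat_trace (mat_adjoint X * \<E> A) + mat_trace (mat_adjoint X * \<E> B)"
      using lin(1)[OF A] lin(1)[OF B] X' unfolding lin(2)[OF A B]
      by (simp add: mult_add_distrib_mat[of _ n n _ n] mat_trace_add[of _ n] mult_carrier_mat[of _ n n _ n])
  next
    fix c and A :: "complex mat" assume A: "A \<in> carrier_mat n n"
    show "mat_trace (mat_adjoint X * \<E> (c \<cdot>\<^sub>m A)) = c * mat_trace (mat_adjoint X * \<E> A)"
      using lin(1)[OF A] X' unfolding lin(3)[OF A]
      by (simp add: mult_smult_distrib[of _ n n _ n] mat_trace_smult[of _ n] mult_carrier_mat[of _ n n _ n])
  qed
  then obtain C where C: "C \<in> carrier_mat n n"
    "\<And>Y. Y \<in> carrier_mat n n \<Longrightarrow> mat_trace (mat_adjoint X * \<E> Y) = mat_trace (C * Y)"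
    by blast
  show ?thesis
    by (rule that[of "mat_adjoint C"]) (use C in \<open>auto simp: mat_adjoint_carrier\<close>)
qed

section \<open>Data processing\<close>

text \<open>A quantum chi-squared divergence: \<open>\<rho> - \<sigma>\<close> has entries of
  squared modulus overlap times (r i - s j)^2 between the two eigenbases, and the denominators are
  the eigenvalues of the superoperator. For nonnegative eigenvalues and 0 < u < 1 a denominator
  vanishes only together with its numerator, so division by zero does no harm.\<close>

definition chi_div :: "nat \<Rightarrow> complex mat \<Rightarrow> (nat \<Rightarrow> real) \<Rightarrow> complex mat \<Rightarrow> (nat \<Rightarrow> real) \<Rightarrow> real \<Rightarrow> real" where
  "chi_div n U r V s u =
     (\<Sum>i<n. \<Sum>j<n. overlap U V i j * ((r i - s j)\<^sup>2 / ((1 - u) * s j + u * r i)))"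

text \<open>\<open>chi_div\<close> is the supremum of \<open>chi_form\<close> over all X, by completing the square in the entries of X
  with respect to the two eigenbases.\<close>

definition chi_form :: "complex mat \<Rightarrow> complex mat \<Rightarrow> real \<Rightarrow> complex mat \<Rightarrow> real" where
  "chi_form \<rho> \<sigma> u X =
     2 * Re (mat_trace (mat_adjoint X * \<rho>) - mat_trace (mat_adjoint X * \<sigma>))
     - (1 - u) * Re (mat_trace (mat_adjoint X * \<sigma> * X)) - u * Re (mat_trace (X * \<rho> * mat_adjoint X))"

text \<open>\<open>\<sigma>\<close> acts on the left of X and \<open>\<rho>\<close> on the right.
  Taking rows of X in the basis V and columns in U makes both actions diagonal at once, and the form
  splits into one scalar quadratic per entry.\<close>

lemma chi_form_coordinates:
  assumes U: "unitary_mat n U" and V: "unitary_mat n V" and X: "X \<in> carrier_mat n n"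
  defines "\<xi> \<equiv> mat_adjoint V * X * U" and "\<beta> \<equiv> mat_adjoint V * U"
  shows "chi_form (spectral_form n U r) (spectral_form n V s) u X =
    (\<Sum>i<n. \<Sum>j<n. 2 * Re (cnj (\<xi> $$ (j, i)) * \<beta> $$ (j, i)) * (r i - s j)
       - (cmod (\<xi> $$ (j, i)))\<^sup>2 * ((1 - u) * s j + u * r i))"
proof -
  note c = unitary_matD(1,2)[OF U] unitary_matD(1,2)[OF V] X mat_adjoint_carrier[OF X]
  note as = assoc_mult_mat[of _ n n _ n _ n] mult_carrier_mat[of _ n n _ n] mat_diag_dim
    left_mult_one_mat[of _ n n] right_mult_one_mat[of _ n n]
  note adj = mat_adjoint_mult[of _ n n _ n]
  let ?R = "mat_diag n (\<lambda>i. complex_of_real (r i))" and ?S = "mat_diag n (\<lambda>i. complex_of_real (s i))"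
  let ?\<rho> = "spectral_form n U r" and ?\<sigma> = "spectral_form n V s"
  have uu: "mat_adjoint U * (U * M) = M" "U * (mat_adjoint U * M) = M"
    "mat_adjoint V * (V * M) = M" "V * (mat_adjoint V * M) = M" if "M \<in> carrier_mat n n" for M
    using that c unitary_matD(3,4)[OF U] unitary_matD(3,4)[OF V]
    by (simp_all add: as(1)[symmetric] as(4))
  have \<xi>: "\<xi> \<in> carrier_mat n n" "mat_adjoint \<xi> \<in> carrier_mat n n"
    and \<beta>: "\<beta> \<in> carrier_mat n n"
    using c by (auto simp: \<xi>_def \<beta>_def as intro!: mat_adjoint_carrier[of _ n n])
  have rot: "mat_trace (mat_adjoint U * M * U) = mat_trace M" "mat_trace (mat_adjoint V * M * V) = mat_trace M"
    if "M \<in> carrier_mat n n" for M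
    using mat_trace_conj[OF unitary_mat_adjoint[OF U] that] mat_trace_conj[OF unitary_mat_adjoint[OF V] that] by simp_all
  have sc: "?\<rho> \<in> carrier_mat n n" "?\<sigma> \<in> carrier_mat n n"
    by (simp_all add: spectral_form_carrier U V)
  have d1: "mat_trace (mat_adjoint X * ?\<rho>) = mat_trace (mat_adjoint \<xi> * (\<beta> * ?R))"
    using c unitary_matD(3,4)[OF U]
    by (subst rot(1)[symmetric], simp add: sc as c) (simp add: spectral_form_def \<xi>_def \<beta>_def adj as uu)
  have d2: "mat_trace (mat_adjoint X * ?\<sigma>) = mat_trace (mat_adjoint \<xi> * (?S * \<beta>))"
    using c
    by (subst rot(1)[symmetric], simp add: sc as c) (simp add: spectral_form_def \<xi>_def \<beta>_def adj as uu)
  have d3: "mat_trace (mat_adjoint X * ?\<sigma> * X) = mat_trace (mat_adjoint \<xi> * (?S * \<xi>))"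
    using c
    by (subst rot(1)[symmetric], simp add: sc as c) (simp add: spectral_form_def \<xi>_def \<beta>_def adj as uu)
  have d4: "mat_trace (X * ?\<rho> * mat_adjoint X) = mat_trace (mat_adjoint \<xi> * (\<xi> * ?R))"
  proof -
    have "mat_trace (X * ?\<rho> * mat_adjoint X) = mat_trace (\<xi> * ?R * mat_adjoint \<xi>)"
      using c
      by (subst rot(2)[symmetric], simp add: sc as c) (simp add: spectral_form_def \<xi>_def \<beta>_def adj as uu)
    also have "\<dots> = mat_trace (mat_adjoint \<xi> * (\<xi> * ?R))"
      using \<xi> by (intro mat_trace_comm[of _ n n]) (simp_all add: as)
    finally show ?thesis .
  qed
  have e: "mat_trace (mat_adjoint \<xi> * M) = (\<Sum>i<n. \<Sum>j<n. cnj (\<xi> $$ (j, i)) * M $$ (j, i))"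
    if "M \<in> carrier_mat n n" for M
    using \<xi> that by (simp add: mat_trace_mult[of _ n n])
  have ent: "(M * ?R) $$ (j, i) = M $$ (j, i) * r i" "(?S * M) $$ (j, i) = s j * M $$ (j, i)"
    if "M \<in> carrier_mat n n" "i < n" "j < n" for M i j
    using that by (simp_all add: mat_diag_mult_right[OF that(1)] mat_diag_mult_left[OF that(1)])
  have sq: "Re (cnj z * (complex_of_real a * z)) = (cmod z)\<^sup>2 * a" "Re (cnj z * (z * complex_of_real a)) = (cmod z)\<^sup>2 * a" for z a
    by (simp_all add: cmod_power2) (simp_all add: power2_eq_square algebra_simps)
  have "chi_form ?\<rho> ?\<sigma> u X = (\<Sum>i<n. \<Sum>j<n.
      2 * (Re (cnj (\<xi> $$ (j, i)) * (\<beta> $$ (j, i) * r i)) - Re (cnj (\<xi> $$ (j, i)) * (s j * \<beta> $$ (j, i))))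
      - (1 - u) * Re (cnj (\<xi> $$ (j, i)) * (s j * \<xi> $$ (j, i))) - u * Re (cnj (\<xi> $$ (j, i)) * (\<xi> $$ (j, i) * r i)))"
    unfolding chi_form_def d1 d2 d3 d4
    using \<xi> \<beta> by (simp add: e as ent sum_subtractf sum_distrib_left Re_sum del: Re_complex_of_real times_complex.sel)
  also have "\<dots> = (\<Sum>i<n. \<Sum>j<n. 2 * Re (cnj (\<xi> $$ (j, i)) * \<beta> $$ (j, i)) * (r i - s j)
       - (cmod (\<xi> $$ (j, i)))\<^sup>2 * ((1 - u) * s j + u * r i))"
    unfolding sq by (intro sum.cong refl) (simp add: algebra_simps)
  finally show ?thesis .
qed

lemma overlap_swap:
  assumes "unitary_mat n U" "unitary_mat n V" "i < n" "j < n"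
  shows "overlap U V i j = (cmod ((mat_adjoint V * U) $$ (j, i)))\<^sup>2"
proof -
  have "mat_adjoint U * V = mat_adjoint (mat_adjoint V * U)"
    using unitary_matD[OF assms(1)] unitary_matD[OF assms(2)] by (simp add: mat_adjoint_mult[of _ n n _ n])
  then show ?thesis
    using assms unitary_matD[OF assms(1)] unitary_matD[OF assms(2)] by (simp add: overlap_def)
qed

text \<open>Complete the square around z = w d / D. If D = 0 the linear term vanishes too, and d^2 /
  D is 0 by convention.\<close>

lemma quadratic_le:
  fixes z w :: complex and d D :: real
  assumes "0 < D \<or> D = 0 \<and> d = 0"
  shows "2 * Re (cnj z * w) * d - (cmod z)\<^sup>2 * D \<le> (cmod w)\<^sup>2 * (d\<^sup>2 / D)"
proof (cases "D = 0")
  case False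
  then have D: "0 < D" using assms by auto
  have "Re (cnj z * w) * d \<le> \<bar>Re (cnj z * w)\<bar> * \<bar>d\<bar>"
    by (metis abs_ge_self abs_mult)
  also have "\<dots> \<le> cmod z * cmod w * \<bar>d\<bar>"
    using abs_Re_le_cmod[of "cnj z * w"] by (intro mult_right_mono) (auto simp: norm_mult)
  finally have 1: "Re (cnj z * w) * d \<le> cmod z * (cmod w * \<bar>d\<bar>)" by (simp add: mult.assoc)
  have "0 \<le> (cmod z * D - cmod w * \<bar>d\<bar>)\<^sup>2 / D" using D by simp
  also have "\<dots> = (cmod z)\<^sup>2 * D - 2 * (cmod z * (cmod w * \<bar>d\<bar>)) + (cmod w)\<^sup>2 * (d\<^sup>2 / D)"
    using D by (simp add: field_simps power2_eq_square abs_mult_self_eq)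
  finally show ?thesis using 1 by linarith
qed (use assms in auto)

lemma mixture_pos_iff:
  fixes a b u :: real
  assumes "0 \<le> a" "0 \<le> b" "0 < u" "u < 1"
  shows "0 < (1 - u) * a + u * b \<or> (1 - u) * a + u * b = 0 \<and> b - a = 0"
proof (cases "a = 0 \<and> b = 0")
  case False
  then have "0 < (1 - u) * a \<or> 0 < u * b" "0 \<le> (1 - u) * a" "0 \<le> u * b"
    using assms by auto
  then show ?thesis by linarith
qed auto

lemma chi_form_le:
  assumes U: "unitary_mat n U" and V: "unitary_mat n V" and X: "X \<in> carrier_mat n n"
    and r: "\<And>i. i < n \<Longrightarrow> 0 \<le> r i" and s: "\<And>i. i < n \<Longrightarrow> 0 \<le> s i" and u: "0 < u" "u < 1"
  shows "chi_form (spectral_form n U r) (spectral_form n V s) u X \<le> chi_div n U r V s u"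
  unfolding chi_form_coordinates[OF U V X] chi_div_def
proof (intro sum_mono)
  fix i j assume ij: "i \<in> {..<n}" "j \<in> {..<n}"
  then show "2 * Re (cnj ((mat_adjoint V * X * U) $$ (j, i)) * (mat_adjoint V * U) $$ (j, i)) * (r i - s j)
       - (cmod ((mat_adjoint V * X * U) $$ (j, i)))\<^sup>2 * ((1 - u) * s j + u * r i)
    \<le> overlap U V i j * ((r i - s j)\<^sup>2 / ((1 - u) * s j + u * r i))"
    using overlap_swap[OF U V, of i j] quadratic_le[OF mixture_pos_iff[of "s j" "r i" u]] r s u by simp
qed

lemma chi_form_attained:
  assumes U: "unitary_mat n U" and V: "unitary_mat n V"
    and r: "\<And>i. i < n \<Longrightarrow> 0 \<le> r i" and s: "\<And>i. i < n \<Longrightarrow> 0 \<le> s i" and u: "0 < u" "u < 1"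
  shows "\<exists>X\<in>carrier_mat n n. chi_form (spectral_form n U r) (spectral_form n V s) u X = chi_div n U r V s u"
proof
  note c = unitary_matD(1,2)[OF U] unitary_matD(1,2)[OF V]
  note as = assoc_mult_mat[of _ n n _ n _ n] mult_carrier_mat[of _ n n _ n] left_mult_one_mat[of _ n n]
  define D where "D i j = (1 - u) * s j + u * r i" for i j
  define \<beta> where "\<beta> = mat_adjoint V * U"
  \<comment> \<open>Entrywise maximizer from completing the square; it is 0 where the denominator is
    0.\<close>
  define \<xi> where "\<xi> = mat n n (\<lambda>(j, i). \<beta> $$ (j, i) * complex_of_real ((r i - s j) / D i j))"
  define X where "X = V * \<xi> * mat_adjoint U"
  have \<xi>: "\<xi> \<in> carrier_mat n n" by (simp add: \<xi>_def)
  show X: "X \<in> carrier_mat n n" using c \<xi> by (simp add: X_def as)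
  have "mat_adjoint V * X * U = (mat_adjoint V * V) * (\<xi> * (mat_adjoint U * U))"
    using c \<xi> by (simp add: X_def as)
  also have "\<dots> = \<xi>" using c \<xi> unitary_matD[OF U] unitary_matD[OF V] by simp
  finally have X\<xi>: "mat_adjoint V * X * U = \<xi>" .
  show "chi_form (spectral_form n U r) (spectral_form n V s) u X = chi_div n U r V s u"
    unfolding chi_form_coordinates[OF U V X] chi_div_def X\<xi> \<beta>_def[symmetric] D_def[symmetric]
  proof (intro sum.cong refl)
    fix i j assume "i \<in> {..<n}" "j \<in> {..<n}"
    then have ij: "i < n" "j < n" by auto
    define b where "b = \<beta> $$ (j, i)"
    have D: "D i j \<noteq> 0 \<or> r i - s j = 0"
      using mixture_pos_iff[of "s j" "r i" u] r[OF ij(1)] s[OF ij(2)] u by (auto simp: D_def)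
    have x: "\<xi> $$ (j, i) = b * complex_of_real ((r i - s j) / D i j)"
      using ij by (simp add: \<xi>_def b_def)
    have re: "Re (cnj (b * complex_of_real t) * b) = (cmod b)\<^sup>2 * t" for t
      by (simp add: cmod_power2) (simp add: power2_eq_square algebra_simps)
    have cm: "(cmod (b * complex_of_real t))\<^sup>2 = (cmod b)\<^sup>2 * t\<^sup>2" for t
      by (simp add: norm_mult power_mult_distrib)
    have "2 * Re (cnj (\<xi> $$ (j, i)) * b) * (r i - s j) - (cmod (\<xi> $$ (j, i)))\<^sup>2 * D i j =
        (cmod b)\<^sup>2 * (2 * ((r i - s j) / D i j) * (r i - s j) - ((r i - s j) / D i j)\<^sup>2 * D i j)"
      unfolding x re cm by (simp add: algebra_simps)
    also have "2 * ((r i - s j) / D i j) * (r i - s j) - ((r i - s j) / D i j)\<^sup>2 * D i j = (r i - s j)\<^sup>2 / D i j"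
      using D by (auto simp: field_simps power2_eq_square)
    finally show "2 * Re (cnj (\<xi> $$ (j, i)) * \<beta> $$ (j, i)) * (r i - s j) - (cmod (\<xi> $$ (j, i)))\<^sup>2 * D i j =
        overlap U V i j * ((r i - s j)\<^sup>2 / D i j)"
      using overlap_swap[OF U V ij] by (simp add: b_def \<beta>_def)
  qed
qed

lemma chi_div_monotone:
  assumes E: "quantum_operation n \<E>"
    and U: "unitary_mat n U" and V: "unitary_mat n V" and U': "unitary_mat n U'" and V': "unitary_mat n V'"
    and r: "\<And>i. i < n \<Longrightarrow> 0 \<le> r i" and s: "\<And>i. i < n \<Longrightarrow> 0 \<le> s i"
    and r': "\<And>i. i < n \<Longrightarrow> 0 \<le> r' i" and s': "\<And>i. i < n \<Longrightarrow> 0 \<le> s' i"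
    and E\<rho>: "\<E> (spectral_form n U r) = spectral_form n U' r'"
    and E\<sigma>: "\<E> (spectral_form n V s) = spectral_form n V' s'"
    and u: "0 < u" "u < 1"
  shows "chi_div n U' r' V' s' u \<le> chi_div n U r V s u"
proof -
  let ?\<rho> = "spectral_form n U r" and ?\<sigma> = "spectral_form n V s"
  have psd: "psd_mat n ?\<rho>" "psd_mat n ?\<sigma>" by (intro spectral_form_psd U V r s; assumption)+
  have c: "?\<rho> \<in> carrier_mat n n" "?\<sigma> \<in> carrier_mat n n" by (simp_all add: spectral_form_carrier U V)
  have Ec: "\<E> M \<in> carrier_mat n n" if "M \<in> carrier_mat n n" for M
    using E that by (simp add: quantum_operation_def linear_mat_map_def)
  obtain X where X: "X \<in> carrier_mat n n"
    and att: "chi_form (\<E> ?\<rho>) (\<E> ?\<sigma>) u X = chi_div n U' r' V' s' u"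
    using chi_form_attained[OF U' V', of r' s' u] r' s' u unfolding E\<rho> E\<sigma> by blast
  obtain Z where Z: "Z \<in> carrier_mat n n"
    and dual: "\<And>Y. Y \<in> carrier_mat n n \<Longrightarrow> mat_trace (mat_adjoint X * \<E> Y) = mat_trace (mat_adjoint Z * Y)"
    using quantum_operation_dual[OF E X] by blast
  note ac = mat_adjoint_carrier[OF X] mat_adjoint_carrier[OF Z]
  \<comment> \<open>The form contains X on both sides, so the Schwarz inequality is needed for X
    with \<open>\<sigma>\<close> and for \<open>mat_adjoint X\<close> with \<open>\<rho>\<close>.
    Because \<open>\<E>\<close> respects adjoints, one Z serves both.\<close>
  have dual': "mat_trace (mat_adjoint (mat_adjoint X) * \<E> Y) = mat_trace (mat_adjoint (mat_adjoint Z) * Y)"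
    if Y: "Y \<in> carrier_mat n n" for Y
  proof -
    have Y': "mat_adjoint Y \<in> carrier_mat n n" using Y by (rule mat_adjoint_carrier)
    have "mat_trace (X * \<E> Y) = mat_trace (\<E> Y * X)"
      using X Ec[OF Y] by (rule mat_trace_comm)
    also have "\<dots> = mat_trace (mat_adjoint (mat_adjoint X * \<E> (mat_adjoint Y)))"
      using X ac Ec[OF Y] by (simp add: quantum_operation_adjoint[OF E Y] mat_adjoint_mult[of _ n n _ n] mat_adjoint_carrier)
    also have "\<dots> = cnj (mat_trace (mat_adjoint Z * mat_adjoint Y))"
      using ac Ec[OF Y'] by (simp add: mat_trace_adjoint[of _ n] mult_carrier_mat[of _ n n _ n] dual[OF Y'])
    also have "\<dots> = mat_trace (mat_adjoint (mat_adjoint Z * mat_adjoint Y))"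
      using ac Y' by (simp add: mat_trace_adjoint[of _ n] mult_carrier_mat[of _ n n _ n])
    also have "\<dots> = mat_trace (Y * Z)"
      using ac Y' by (simp add: mat_adjoint_mult[of _ n n _ n])
    also have "\<dots> = mat_trace (Z * Y)" using Y Z by (rule mat_trace_comm)
    finally show ?thesis by simp
  qed
  have s1: "mat_trace (mat_adjoint Z * ?\<sigma> * Z) \<le> mat_trace (mat_adjoint X * \<E> ?\<sigma> * X)"
    by (rule quantum_operation_schwarz[OF E psd(2) X Z dual])
  have s2: "mat_trace (Z * ?\<rho> * mat_adjoint Z) \<le> mat_trace (X * \<E> ?\<rho> * mat_adjoint X)"
    using quantum_operation_schwarz[OF E psd(1) ac dual'] by simp
  have "chi_form (\<E> ?\<rho>) (\<E> ?\<sigma>) u X \<le> chi_form ?\<rho> ?\<sigma> u Z"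
  proof -
    have "(1 - u) * Re (mat_trace (mat_adjoint Z * ?\<sigma> * Z)) \<le> (1 - u) * Re (mat_trace (mat_adjoint X * \<E> ?\<sigma> * X))"
      "u * Re (mat_trace (Z * ?\<rho> * mat_adjoint Z)) \<le> u * Re (mat_trace (X * \<E> ?\<rho> * mat_adjoint X))"
      using s1 s2 u by (auto intro!: mult_left_mono simp: less_eq_complex_def)
    then show ?thesis
      unfolding chi_form_def dual[OF c(1)] dual[OF c(2)] by linarith
  qed
  also have "\<dots> \<le> chi_div n U r V s u"
    by (rule chi_form_le[OF U V Z]) (use r s u in auto)
  finally show ?thesis using att by simp
qed

text \<open>Relative entropy of two matrices given by eigendata. As \<open>ln 0 = 0\<close> in the library, it is the usual
  one only if the kernel of the second matrix lies in that of the first, see \<open>abs_cont\<close> below.\<close>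

definition rel_entropy :: "nat \<Rightarrow> complex mat \<Rightarrow> (nat \<Rightarrow> real) \<Rightarrow> complex mat \<Rightarrow> (nat \<Rightarrow> real) \<Rightarrow> real" where
  "rel_entropy n U r V s = (\<Sum>i<n. \<Sum>j<n. overlap U V i j * (r i * ln (r i) - r i * ln (s j)))"

definition abs_cont :: "nat \<Rightarrow> complex mat \<Rightarrow> (nat \<Rightarrow> real) \<Rightarrow> complex mat \<Rightarrow> (nat \<Rightarrow> real) \<Rightarrow> bool" where
  "abs_cont n U r V s \<longleftrightarrow> (\<forall>i<n. \<forall>j<n. s j = 0 \<longrightarrow> overlap U V i j * r i = 0)"

text \<open>G is an explicit antiderivative: r ln (s + u (r - s)) - u (r - s) has derivative (1 - u)
  (r - s)^2 / (s + u (r - s)). Its linear part leaves a difference of traces at the end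
  points.\<close>

lemma rel_entropy_integral:
  fixes r s :: "nat \<Rightarrow> real"
  assumes U: "unitary_mat n U" and V: "unitary_mat n V"
    and r: "\<And>i. i < n \<Longrightarrow> 0 \<le> r i" and s: "\<And>i. i < n \<Longrightarrow> 0 \<le> s i"
    and ac: "abs_cont n U r V s"
  defines "G \<equiv> \<lambda>u. \<Sum>i<n. \<Sum>j<n. overlap U V i j * (r i * ln (s j + u * (r i - s j)) - u * (r i - s j))"
  shows "continuous_on {0..1} G"
    and "0 < u \<Longrightarrow> u < 1 \<Longrightarrow> (G has_real_derivative (1 - u) * chi_div n U r V s u) (at u)"
    and "G 1 - G 0 = rel_entropy n U r V s - (sum r {..<n} - sum s {..<n})"
proof -
  define g where "g i j u = overlap U V i j * (r i * ln (s j + u * (r i - s j)) - u * (r i - s j))" for i j u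
  have G: "G = (\<lambda>u. \<Sum>i<n. \<Sum>j<n. g i j u)" by (simp add: G_def g_def)
  \<comment> \<open>Absolute continuity kills every term with s j = 0, including its numerator (r
    i)^2 in \<open>chi_div\<close>.\<close>
  have dichotomy: "(\<forall>u. g i j u = 0) \<and> overlap U V i j * (r i)\<^sup>2 = 0 \<and> s j = 0 \<or> 0 < s j" if ij: "i < n" "j < n" for i j
  proof (cases "s j = 0")
    case True
    then have z: "overlap U V i j * r i = 0" using ac ij by (auto simp: abs_cont_def)
    have "g i j u = overlap U V i j * r i * ln (s j + u * (r i - s j)) - u * (overlap U V i j * r i)" for u
      by (simp add: g_def True algebra_simps)
    then show ?thesis using z True by auto
  qed (use s[OF ij(2)] in auto)
  have pos: "0 < s j + u * (r i - s j)" if "i < n" "j < n" "0 < s j" "0 \<le> u" "u < 1" for i j u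
  proof -
    have "0 < (1 - u) * s j" "0 \<le> u * r i" using that r by auto
    then show ?thesis by (simp add: algebra_simps)
  qed
  \<comment> \<open>The argument of ln is s j at u = 0 and r i at u = 1; where it vanishes, the
    logarithm has the factor \<open>overlap U V i j * r i\<close>, which is 0.\<close>
  have "continuous_on {0..1} (g i j)" if ij: "i < n" "j < n" for i j
  proof (cases "r i = 0 \<or> s j = 0")
    case True
    then have "g i j = (\<lambda>_. 0) \<or> g i j = (\<lambda>u. overlap U V i j * (u * s j))"
      using dichotomy[OF ij] by (auto simp: g_def fun_eq_iff)
    then show ?thesis by (elim disjE) (auto intro!: continuous_intros)
  next
    case False
    then have rs: "0 < r i" "0 < s j" using r[OF ij(1)] s[OF ij(2)] by auto
    have "0 < s j + u * (r i - s j)" if "u \<in> {0..1}" for u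
      using pos[OF ij rs(2), of u] rs that by (cases "u = 1") auto
    then have "\<forall>u\<in>{0..1}. s j + u * (r i - s j) \<noteq> 0" by force
    then show ?thesis unfolding g_def by (intro continuous_intros) auto
  qed
  then show "continuous_on {0..1} G" unfolding G by (intro continuous_on_sum) auto
  show "(G has_real_derivative (1 - u) * chi_div n U r V s u) (at u)" if u: "0 < u" "u < 1"
  proof -
    have "(g i j has_real_derivative (1 - u) * (overlap U V i j * ((r i - s j)\<^sup>2 / ((1 - u) * s j + u * r i)))) (at u)"
      if ij: "i < n" "j < n" for i j
      using dichotomy[OF ij]
    proof
      assume h: "(\<forall>u. g i j u = 0) \<and> overlap U V i j * (r i)\<^sup>2 = 0 \<and> s j = 0"
      then have "g i j = (\<lambda>_. 0)" by auto
      then show ?thesis using h by (auto simp: power2_eq_square)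
    next
      assume sj: "0 < s j"
      have p: "0 < s j + u * (r i - s j)" using pos[OF ij sj] u by simp
      have q: "(1 - u) * s j + u * r i = s j + u * (r i - s j)" by (simp add: algebra_simps)
      have "(g i j has_real_derivative overlap U V i j * (r i * ((r i - s j) / (s j + u * (r i - s j))) - (r i - s j))) (at u)"
        unfolding g_def using p by (auto intro!: derivative_eq_intros)
      also have "r i * ((r i - s j) / (s j + u * (r i - s j))) - (r i - s j) = (1 - u) * ((r i - s j)\<^sup>2 / (s j + u * (r i - s j)))"
        using p by (simp add: field_simps power2_eq_square)
      finally show ?thesis unfolding q by (simp add: mult.left_commute)
    qed
    then have "(G has_real_derivative (\<Sum>i<n. \<Sum>j<n. (1 - u) * (overlap U V i j * ((r i - s j)\<^sup>2 / ((1 - u) * s j + u * r i))))) (at u)"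
      unfolding G by (intro DERIV_sum) auto
    then show ?thesis by (simp add: chi_div_def sum_distrib_left)
  qed
  have "G 1 - G 0 = rel_entropy n U r V s
      - ((\<Sum>i<n. \<Sum>j<n. overlap U V i j * r i) - (\<Sum>i<n. \<Sum>j<n. overlap U V i j * s j))"
    by (simp add: G_def rel_entropy_def sum_subtractf[symmetric] algebra_simps)
  then show "G 1 - G 0 = rel_entropy n U r V s - (sum r {..<n} - sum s {..<n})"
    by (simp add: overlap_sum_left[OF U V] overlap_sum_right[OF U V])
qed

text \<open>Trace preservation makes the trace corrections of input and output equal, so comparing
  the increments of the two antiderivatives over [0, 1] compares the entropies.\<close>

theorem rel_entropy_monotone:
  assumes E: "quantum_operation n \<E>"
    and U: "unitary_mat n U" and V: "unitary_mat n V" and U': "unitary_mat n U'" and V': "unitary_mat n V'"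
    and r: "\<And>i. i < n \<Longrightarrow> 0 \<le> r i" and s: "\<And>i. i < n \<Longrightarrow> 0 \<le> s i"
    and r': "\<And>i. i < n \<Longrightarrow> 0 \<le> r' i" and s': "\<And>i. i < n \<Longrightarrow> 0 \<le> s' i"
    and ac: "abs_cont n U r V s" and ac': "abs_cont n U' r' V' s'"
    and E\<rho>: "\<E> (spectral_form n U r) = spectral_form n U' r'"
    and E\<sigma>: "\<E> (spectral_form n V s) = spectral_form n V' s'"
  shows "rel_entropy n U' r' V' s' \<le> rel_entropy n U r V s"
proof -
  have tr: "mat_trace (\<E> M) = mat_trace M" if "M \<in> carrier_mat n n" for M
    using E that by (simp add: quantum_operation_def trace_preserving_def)
  have "complex_of_real (sum r' {..<n}) = complex_of_real (sum r {..<n})"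
    using tr[OF spectral_form_carrier[OF U, of r]]
    unfolding E\<rho> spectral_form_trace[OF U] spectral_form_trace[OF U'] .
  then have sr: "sum r' {..<n} = sum r {..<n}" unfolding of_real_eq_iff .
  have "complex_of_real (sum s' {..<n}) = complex_of_real (sum s {..<n})"
    using tr[OF spectral_form_carrier[OF V, of s]]
    unfolding E\<sigma> spectral_form_trace[OF V] spectral_form_trace[OF V'] .
  then have ss: "sum s' {..<n} = sum s {..<n}" unfolding of_real_eq_iff .
  define G where "G U V r s u = (\<Sum>i<n. \<Sum>j<n. overlap U V i j *
      (r i * ln (s j + u * (r i - s j)) - u * (r i - s j)))" for U V and r s :: "nat \<Rightarrow> real" and u
  note int = rel_entropy_integral[OF U V r s ac, folded G_def]
    and int' = rel_entropy_integral[OF U' V' r' s' ac', folded G_def]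
  have "G U V r s 0 - G U' V' r' s' 0 \<le> G U V r s 1 - G U' V' r' s' 1"
  proof (rule DERIV_nonneg_imp_increasing_open[of 0 1 "\<lambda>u. G U V r s u - G U' V' r' s' u"])
    fix u :: real assume u: "0 < u" "u < 1"
    have "((\<lambda>u. G U V r s u - G U' V' r' s' u) has_real_derivative
        (1 - u) * chi_div n U r V s u - (1 - u) * chi_div n U' r' V' s' u) (at u)"
      by (intro DERIV_diff int(2) int'(2) u)
    moreover have "(1 - u) * chi_div n U' r' V' s' u \<le> (1 - u) * chi_div n U r V s u"
      using chi_div_monotone[OF E U V U' V' r s r' s' E\<rho> E\<sigma> u] u by (intro mult_left_mono) auto
    ultimately show "\<exists>y. ((\<lambda>u. G U V r s u - G U' V' r' s' u) has_real_derivative y) (at u) \<and> 0 \<le> y"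
      by force
  qed (auto intro!: continuous_intros int(1) int'(1))
  then show ?thesis using int(3) int'(3) sr ss by simp
qed

text \<open>An eigenvalue 0 of the mean is half a sum of nonnegative terms, so every term is 0.
  Hence the relative entropies to the mean are the genuine ones.\<close>

lemma mean_eigenvalue_zero:
  assumes U: "unitary_mat n U" and V: "unitary_mat n V" and W: "unitary_mat n W"
    and M: "(1/2) \<cdot>\<^sub>m (spectral_form n U x + spectral_form n V y) = spectral_form n W m"
    and x: "\<And>i. i < n \<Longrightarrow> 0 \<le> x i" and y: "\<And>i. i < n \<Longrightarrow> 0 \<le> y i"
  shows "abs_cont n U x W m" "abs_cont n V y W m"
proof -
  have nonneg: "0 \<le> overlap U W i k * x i" "0 \<le> overlap V W i k * y i" if "i < n" for i k
    using that x y overlap_nonneg by simp_all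
  have "overlap U W i k * x i = 0 \<and> overlap V W i k * y i = 0" if k: "k < n" "m k = 0" and i: "i < n" for i k
  proof -
    have "(\<Sum>i<n. overlap U W i k * x i) + (\<Sum>j<n. overlap V W j k * y j) = 0"
      using mean_eigenvalue[OF U V W M k(1)] k(2) by simp
    moreover have "0 \<le> (\<Sum>i<n. overlap U W i k * x i)" "0 \<le> (\<Sum>j<n. overlap V W j k * y j)"
      using nonneg by (auto intro!: sum_nonneg)
    ultimately have "(\<Sum>i<n. overlap U W i k * x i) = 0" "(\<Sum>j<n. overlap V W j k * y j) = 0" by linarith+
    then show ?thesis
      using i nonneg sum_nonneg_eq_0_iff[of "{..<n}" "\<lambda>i. overlap U W i k * x i"]
        sum_nonneg_eq_0_iff[of "{..<n}" "\<lambda>i. overlap V W i k * y i"] by auto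
  qed
  then show "abs_cont n U x W m" "abs_cont n V y W m" by (simp_all add: abs_cont_def)
qed

text \<open>The cross terms with \<open>ln (m k)\<close> are weighted by the overlap averages of x
  and y, whose mean is \<open>m k\<close>; together they form the entropy of the mean.\<close>

lemma qjsd_rel_entropy:
  assumes U: "unitary_mat n U" and V: "unitary_mat n V" and W: "unitary_mat n W"
    and M: "(1/2) \<cdot>\<^sub>m (spectral_form n U x + spectral_form n V y) = spectral_form n W m"
  shows "ln 2 * qjsd (spectral_form n U x) (spectral_form n V y) =
    (rel_entropy n U x W m + rel_entropy n V y W m) / 2"
proof -
  have rel: "rel_entropy n U' d W m = (\<Sum>i<n. d i * ln (d i)) - (\<Sum>k<n. (\<Sum>i<n. overlap U' W i k * d i) * ln (m k))"
    if U': "unitary_mat n U'" for U' d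
  proof -
    have "rel_entropy n U' d W m = (\<Sum>i<n. \<Sum>k<n. overlap U' W i k * (d i * ln (d i)))
        - (\<Sum>i<n. \<Sum>k<n. overlap U' W i k * d i * ln (m k))"
      by (simp add: rel_entropy_def sum_subtractf right_diff_distrib mult.assoc)
    also have "(\<Sum>i<n. \<Sum>k<n. overlap U' W i k * d i * ln (m k)) = (\<Sum>k<n. (\<Sum>i<n. overlap U' W i k * d i) * ln (m k))"
      by (subst sum.swap) (simp add: sum_distrib_right)
    finally show ?thesis by (simp add: overlap_sum_left[OF U' W])
  qed
  have "(\<Sum>k<n. m k * ln (m k)) =
      (\<Sum>k<n. (\<Sum>i<n. overlap U W i k * x i) * ln (m k) / 2 + (\<Sum>i<n. overlap V W i k * y i) * ln (m k) / 2)"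
    by (intro sum.cong refl) (simp add: mean_eigenvalue[OF U V W M] algebra_simps add_divide_distrib)
  then have "(\<Sum>k<n. m k * ln (m k)) = (\<Sum>k<n. (\<Sum>i<n. overlap U W i k * x i) * ln (m k)) / 2
      + (\<Sum>k<n. (\<Sum>i<n. overlap V W i k * y i) * ln (m k)) / 2"
    by (simp add: sum.distrib sum_divide_distrib)
  then show ?thesis
    unfolding qjsd_def M vn_entropy_spectral_form[OF U] vn_entropy_spectral_form[OF V]
      vn_entropy_spectral_form[OF W] rel[OF U] rel[OF V]
    by (simp add: algebra_simps add_divide_distrib diff_divide_distrib)
qed

text \<open>Complete positivity with a one-dimensional ancilla.\<close>

lemma quantum_operation_psd:
  assumes E: "quantum_operation n \<E>" and A: "psd_mat n A"
  shows "psd_mat n (\<E> A)"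
proof -
  have Ac: "A \<in> carrier_mat n n" using A by (simp add: psd_mat_def)
  then have EA: "\<E> A \<in> carrier_mat n n"
    using E by (simp add: quantum_operation_def linear_mat_map_def)
  have "ancilla_block n 1 A 0 0 = A"
    using Ac by (intro eq_matI) (auto simp: ancilla_block_def)
  then have "tensor_id n 1 \<E> A = \<E> A"
    using EA by (intro eq_matI) (auto simp: tensor_id_def)
  moreover have "psd_mat (n * 1) (tensor_id n 1 \<E> A)"
    using E A unfolding quantum_operation_def completely_positive_def by (metis mult_1_right)
  ultimately show ?thesis by simp
qed

theorem qjsd_monotone:
  assumes E: "quantum_operation n \<E>" and A: "psd_mat n A" and B: "psd_mat n B"
  shows "qjsd (\<E> A) (\<E> B) \<le> qjsd A B"
proof -
  have c: "A \<in> carrier_mat n n" "B \<in> carrier_mat n n" using A B by (auto simp: psd_mat_def)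
  have lin: "\<E> ((1/2) \<cdot>\<^sub>m (A + B)) = (1/2) \<cdot>\<^sub>m (\<E> A + \<E> B)"
    using E c by (simp add: quantum_operation_def linear_mat_map_def)
  obtain U x where U: "unitary_mat n U" "A = spectral_form n U x" and x: "\<And>i. i < n \<Longrightarrow> 0 \<le> x i"
    using psd_spectral_form[OF A] by blast
  obtain V y where V: "unitary_mat n V" "B = spectral_form n V y" and y: "\<And>i. i < n \<Longrightarrow> 0 \<le> y i"
    using psd_spectral_form[OF B] by blast
  obtain W m where W: "unitary_mat n W" "(1/2) \<cdot>\<^sub>m (A + B) = spectral_form n W m"
    and m: "\<And>i. i < n \<Longrightarrow> 0 \<le> m i"
    using psd_spectral_form[OF psd_mat_mean[OF A B]] by blast
  note EA = quantum_operation_psd[OF E A] and EB = quantum_operation_psd[OF E B]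
  obtain U' x' where U': "unitary_mat n U'" "\<E> A = spectral_form n U' x'" and x': "\<And>i. i < n \<Longrightarrow> 0 \<le> x' i"
    using psd_spectral_form[OF EA] by blast
  obtain V' y' where V': "unitary_mat n V'" "\<E> B = spectral_form n V' y'" and y': "\<And>i. i < n \<Longrightarrow> 0 \<le> y' i"
    using psd_spectral_form[OF EB] by blast
  obtain W' m' where W': "unitary_mat n W'" "(1/2) \<cdot>\<^sub>m (\<E> A + \<E> B) = spectral_form n W' m'"
    and m': "\<And>i. i < n \<Longrightarrow> 0 \<le> m' i"
    using psd_spectral_form[OF psd_mat_mean[OF EA EB]] by blast
  have M: "(1/2) \<cdot>\<^sub>m (spectral_form n U x + spectral_form n V y) = spectral_form n W m"
    and M': "(1/2) \<cdot>\<^sub>m (spectral_form n U' x' + spectral_form n V' y') = spectral_form n W' m'"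
    using W(2) W'(2) unfolding U'(2) V'(2) by (simp_all add: U(2) V(2))
  note ac = mean_eigenvalue_zero[OF U(1) V(1) W(1) M x y]
    and ac' = mean_eigenvalue_zero[OF U'(1) V'(1) W'(1) M' x' y']
  \<comment> \<open>By linearity the image of the mean is the mean of the images, so both relative
    entropies keep a common second argument.\<close>
  have EM: "\<E> (spectral_form n W m) = spectral_form n W' m'"
    using lin W(2) W'(2) by simp
  have "rel_entropy n U' x' W' m' \<le> rel_entropy n U x W m"
    by (rule rel_entropy_monotone[OF E U(1) W(1) U'(1) W'(1) x m x' m' ac(1) ac'(1) _ EM])
      (use U(2) U'(2) in auto)
  moreover have "rel_entropy n V' y' W' m' \<le> rel_entropy n V y W m"
    by (rule rel_entropy_monotone[OF E V(1) W(1) V'(1) W'(1) y m y' m' ac(2) ac'(2) _ EM])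
      (use V(2) V'(2) in auto)
  ultimately have "(rel_entropy n U' x' W' m' + rel_entropy n V' y' W' m') / 2 \<le>
      (rel_entropy n U x W m + rel_entropy n V y W m) / 2"
    by simp
  then have "ln 2 * qjsd (\<E> A) (\<E> B) \<le> ln 2 * qjsd A B"
    unfolding U'(2) V'(2) unfolding U(2) V(2)
      qjsd_rel_entropy[OF U(1) V(1) W(1) M] qjsd_rel_entropy[OF U'(1) V'(1) W'(1) M'] .
  then show ?thesis by simp
qed

section \<open>Ancillas, boundedness and the theorem\<close>

lemma tensor_id_carrier: "tensor_id N K \<E> X \<in> carrier_mat (N * K) (N * K)"
  by (simp add: tensor_id_def)

text \<open>Two successive ancillas are one ancilla of dimension K * k. This reduces complete
  positivity of the extension to that of \<open>\<E>\<close>.\<close>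

lemma tensor_id_tensor_id:
  assumes E: "linear_mat_map N \<E>"
  shows "tensor_id (N * K) k (tensor_id N K \<E>) X = tensor_id N (K * k) \<E> X"
proof (rule eq_matI)
  show "dim_row (tensor_id (N * K) k (tensor_id N K \<E>) X) = dim_row (tensor_id N (K * k) \<E> X)"
    "dim_col (tensor_id (N * K) k (tensor_id N K \<E>) X) = dim_col (tensor_id N (K * k) \<E> X)"
    by (simp_all add: tensor_id_def)
  fix r c assume "r < dim_row (tensor_id N (K * k) \<E> X)" "c < dim_col (tensor_id N (K * k) \<E> X)"
  then have rc: "r < N * K * k" "c < N * K * k" by (simp_all add: tensor_id_def)
  \<comment> \<open>Mixed-radix digits: the joint ancilla index has leading digit r div k mod K and
    last digit r mod k.\<close>
  have digit: "r div k div K = r div (K * k)" "r mod (K * k) = r div k mod K * k + r mod k" for r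
    using div_mult2_eq[of r k K] mod_mult2_eq[of r k K] by (simp_all add: mult.commute)
  have idx: "(i * K + a) * k + b = i * (K * k) + (a * k + b)" for i a b :: nat
    by (simp add: algebra_simps)
  have blk: "ancilla_block N K (ancilla_block (N * K) k X b b') a a' = ancilla_block N (K * k) X (a * k + b) (a' * k + b')"
    if "a < K" "a' < K" for a a' b b'
    using that by (intro eq_matI) (auto simp: ancilla_block_def nat_pair_index_less idx)
  note less = div_mod_index_less[OF rc(1)] div_mod_index_less[OF rc(2)]
  note less' = div_mod_index_less[OF less(1)] div_mod_index_less[OF less(3)]
  show "tensor_id (N * K) k (tensor_id N K \<E>) X $$ (r, c) = tensor_id N (K * k) \<E> X $$ (r, c)"
    using rc less by (simp add: tensor_id_def blk[OF less'(2,4)] digit mult.assoc)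
qed

lemma quantum_operation_tensor_id:
  assumes E: "quantum_operation N \<E>"
  shows "quantum_operation (N * K) (tensor_id N K \<E>)"
  unfolding quantum_operation_def
proof (intro conjI)
  have lin: "linear_mat_map N \<E>" and cp: "completely_positive N \<E>" and tp: "trace_preserving N \<E>"
    using E by (simp_all add: quantum_operation_def)
  show "linear_mat_map (N * K) (tensor_id N K \<E>)"
    using tensor_id_carrier tensor_id_add[OF lin] tensor_id_smult[OF lin]
    by (simp add: linear_mat_map_def)
  show "completely_positive (N * K) (tensor_id N K \<E>)"
    using cp unfolding completely_positive_def tensor_id_tensor_id[OF lin] by (simp add: mult.assoc)
  show "trace_preserving (N * K) (tensor_id N K \<E>)"
    unfolding trace_preserving_def
  proof
    fix X :: "complex mat" assume X: "X \<in> carrier_mat (N * K) (N * K)"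
    have c: "ancilla_block N K X a b \<in> carrier_mat N N" for a b by (simp add: ancilla_block_def)
    have Ec: "\<E> (ancilla_block N K X a b) \<in> carrier_mat N N" for a b
      using lin c by (simp add: linear_mat_map_def)
    \<comment> \<open>Only the diagonal ancilla blocks meet the diagonal of the large matrix, and on
      each of them the trace is preserved.\<close>
    have "mat_trace (tensor_id N K \<E> X) = (\<Sum>i<N. \<Sum>a<K. \<E> (ancilla_block N K X a a) $$ (i, i))"
      by (simp add: mat_trace_def tensor_id_def sum_nat_pair nat_pair_index_less)
    also have "\<dots> = (\<Sum>a<K. mat_trace (\<E> (ancilla_block N K X a a)))"
      by (subst sum.swap) (simp add: mat_trace_def carrier_matD(1)[OF Ec])
    also have "\<dots> = (\<Sum>a<K. mat_trace (ancilla_block N K X a a))"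
      using tp c by (simp add: trace_preserving_def)
    also have "\<dots> = (\<Sum>i<N. \<Sum>a<K. X $$ (i * K + a, i * K + a))"
      by (subst sum.swap) (simp add: mat_trace_def ancilla_block_def)
    also have "\<dots> = mat_trace X"
      using X by (simp add: mat_trace_def sum_nat_pair)
    finally show "mat_trace (tensor_id N K \<E> X) = mat_trace X" .
  qed
qed

section \<open>Density matrices: existence and bounds for entropy and distance\<close>

lemma quantum_operation_density:
  assumes "quantum_operation n \<E>" "\<rho> \<in> density_mats n"
  shows "\<E> \<rho> \<in> density_mats n"
  using assms quantum_operation_psd[of n \<E> \<rho>]
  by (auto simp: density_mats_def quantum_operation_def trace_preserving_def psd_mat_def)

lemma density_mats_nonempty:
  assumes "0 < n"
  shows "density_mats n \<noteq> {}"
proof -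
  have "mat_trace (spectral_form n (1\<^sub>m n) (\<lambda>_. 1 / n)) = 1"
    using assms by (simp only: spectral_form_trace[OF unitary_mat_one]) simp
  moreover have "psd_mat n (spectral_form n (1\<^sub>m n) (\<lambda>_. 1 / n))"
    by (rule spectral_form_psd[OF unitary_mat_one]) simp
  ultimately show ?thesis by (auto simp: density_mats_def)
qed

text \<open>Any bound uniform over density matrices serves to make the suprema finite; this one
  comes from -d ln d \<le> 1 - d \<le> 1 for each eigenvalue.\<close>

lemma vn_entropy_density_bounds:
  assumes \<rho>: "\<rho> \<in> density_mats n"
  shows "0 \<le> vn_entropy \<rho>" "vn_entropy \<rho> \<le> n / ln 2"
proof -
  obtain U d where U: "unitary_mat n U" "\<rho> = spectral_form n U d" and d: "\<And>i. i < n \<Longrightarrow> 0 \<le> d i"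
    using psd_spectral_form[of n \<rho>] \<rho> by (auto simp: density_mats_def)
  have "complex_of_real (\<Sum>i<n. d i) = 1"
    using \<rho> unfolding U(2) density_mats_def by (simp add: spectral_form_trace[OF U(1)] del: of_real_sum)
  then have tr: "(\<Sum>i<n. d i) = 1" unfolding of_real_eq_1_iff .
  have d1: "d i \<le> 1" if "i < n" for i
    using member_le_sum[of i "{..<n}" d] that d tr by auto
  have "0 \<le> - (d i * ln (d i)) \<and> - (d i * ln (d i)) \<le> 1" if i: "i < n" for i
  proof (cases "d i = 0")
    case False
    then have p: "0 < d i" using d[OF i] by simp
    have "ln (1 / d i) \<le> 1 / d i - 1" using p by (intro ln_le_minus_one) simp
    then have "d i * ln (1 / d i) \<le> d i * (1 / d i - 1)" using p by (intro mult_left_mono) auto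
    then have "- (d i * ln (d i)) \<le> 1 - d i" using p by (simp add: ln_div right_diff_distrib)
    moreover have "d i * ln (d i) \<le> 0"
      using p d1[OF i] by (simp add: mult_nonneg_nonpos)
    ultimately show ?thesis using p by linarith
  qed simp
  then have "0 \<le> (\<Sum>i<n. - (d i * ln (d i)))" "(\<Sum>i<n. - (d i * ln (d i))) \<le> (\<Sum>i<n. 1)"
    by (intro sum_nonneg sum_mono; simp)+
  then have "0 \<le> (\<Sum>i<n. - (d i * ln (d i))) / ln 2" "(\<Sum>i<n. - (d i * ln (d i))) / ln 2 \<le> n / ln 2"
    by (auto intro: divide_right_mono)
  then show "0 \<le> vn_entropy \<rho>" "vn_entropy \<rho> \<le> n / ln 2"
    unfolding U(2) vn_entropy_spectral_form[OF U(1)] sum_negf by simp_all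
qed

lemma density_mats_mean:
  assumes "\<rho> \<in> density_mats n" "\<sigma> \<in> density_mats n"
  shows "(1/2) \<cdot>\<^sub>m (\<rho> + \<sigma>) \<in> density_mats n"
proof -
  have c: "\<rho> \<in> carrier_mat n n" "\<sigma> \<in> carrier_mat n n"
    using assms by (auto simp: density_mats_def psd_mat_def)
  show ?thesis
    using assms psd_mat_mean[of n \<rho> \<sigma>] c
    by (simp add: density_mats_def mat_trace_smult[of _ n] mat_trace_add[of _ n])
qed

lemma transmission_dist_le:
  assumes "\<rho> \<in> density_mats n" "\<sigma> \<in> density_mats n"
  shows "transmission_dist \<rho> \<sigma> \<le> sqrt (n / ln 2)"
  unfolding transmission_dist_def qjsd_def
  using vn_entropy_density_bounds[OF assms(1)] vn_entropy_density_bounds[OF assms(2)]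
    vn_entropy_density_bounds[OF density_mats_mean[OF assms]]
  by (intro real_sqrt_le_mono) linarith

lemma transmission_dist_nonneg:
  assumes "\<rho> \<in> density_mats n" "\<sigma> \<in> density_mats n"
  shows "0 \<le> transmission_dist \<rho> \<sigma>"
  using assms qjsd_nonneg[of n \<rho> \<sigma>] by (simp add: transmission_dist_def density_mats_def)

lemma transmission_dist_self:
  assumes "\<rho> \<in> carrier_mat n n"
  shows "transmission_dist \<rho> \<rho> = 0"
proof -
  have "(1/2) \<cdot>\<^sub>m (\<rho> + \<rho>) = \<rho>" using assms by (intro eq_matI) auto
  then show ?thesis by (simp add: transmission_dist_def qjsd_def)
qed

theorem mainTheorem2:
  fixes N K :: nat and \<E> \<F> :: "complex mat \<Rightarrow> complex mat"
  assumes "N \<ge> 1" and "K \<ge> 1"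
    and "quantum_operation N \<E>" and "quantum_operation N \<F>"
  shows "amortized_divergence N K \<E> \<F> = channel_divergence N K \<E> \<F>"
proof -
  let ?D = "density_mats (N * K)" and ?E = "tensor_id N K \<E>" and ?F = "tensor_id N K \<F>"
  let ?d = transmission_dist
  note E = quantum_operation_tensor_id[OF assms(3), of K] and F = quantum_operation_tensor_id[OF assms(4), of K]
  note ED = quantum_operation_density[OF E] and FD = quantum_operation_density[OF F]
  have ne: "?D \<noteq> {}" using assms(1,2) by (intro density_mats_nonempty) simp
  let ?c = "\<lambda>\<sigma>. ?d (?E \<sigma>) (?F \<sigma>)" and ?a = "\<lambda>(\<rho>, \<sigma>). ?d (?E \<rho>) (?F \<sigma>) - ?d \<rho> \<sigma>"
  have bc: "bdd_above (?c ` ?D)"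
    by (rule bdd_aboveI2) (rule transmission_dist_le[OF ED FD])
  \<comment> \<open>The subtracted distance is nonnegative, so the uniform bound for the distance of
    the outputs also bounds the difference.\<close>
  have ba: "bdd_above (?a ` (?D \<times> ?D))"
  proof (rule bdd_aboveI2)
    fix p assume "p \<in> ?D \<times> ?D"
    then obtain \<rho> \<sigma> where p: "p = (\<rho>, \<sigma>)" "\<rho> \<in> ?D" "\<sigma> \<in> ?D" by auto
    show "?a p \<le> sqrt (real (N * K) / ln 2)"
      using transmission_dist_le[OF ED[OF p(2)] FD[OF p(3)]] transmission_dist_nonneg[OF p(2,3)]
      by (simp add: p(1))
  qed
  have le: "?a (\<rho>, \<sigma>) \<le> ?c \<sigma>" if D: "\<rho> \<in> ?D" "\<sigma> \<in> ?D" for \<rho> \<sigma>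
  proof -
    have psd: "psd_mat (N * K) M" if "M \<in> ?D" for M using that by (simp add: density_mats_def)
    have "?d (?E \<rho>) (?F \<sigma>) \<le> ?d (?E \<rho>) (?E \<sigma>) + ?d (?E \<sigma>) (?F \<sigma>)"
      by (intro transmission_dist_triangle[of "N * K"] psd ED FD D)
    moreover have "?d (?E \<rho>) (?E \<sigma>) \<le> ?d \<rho> \<sigma>"
      unfolding transmission_dist_def
      by (intro real_sqrt_le_mono qjsd_monotone[OF E] psd D)
    ultimately show ?thesis by simp
  qed
  have "(SUP p\<in>?D \<times> ?D. ?a p) \<le> (SUP \<sigma>\<in>?D. ?c \<sigma>)"
  proof (rule cSUP_least)
    fix p assume "p \<in> ?D \<times> ?D"
    then obtain \<rho> \<sigma> where p: "p = (\<rho>, \<sigma>)" "\<rho> \<in> ?D" "\<sigma> \<in> ?D" by auto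
    show "?a p \<le> (SUP \<sigma>\<in>?D. ?c \<sigma>)"
      unfolding p(1) by (rule order_trans[OF le[OF p(2,3)] cSUP_upper[OF p(3) bc]])
  qed (use ne in auto)
  moreover have "(SUP \<sigma>\<in>?D. ?c \<sigma>) \<le> (SUP p\<in>?D \<times> ?D. ?a p)"
  proof (rule cSUP_least[OF ne])
    fix \<sigma> assume \<sigma>: "\<sigma> \<in> ?D"
    then have "\<sigma> \<in> carrier_mat (N * K) (N * K)" by (simp add: density_mats_def psd_mat_def)
    then have "?c \<sigma> = ?a (\<sigma>, \<sigma>)" by (simp add: transmission_dist_self)
    also have "\<dots> \<le> (SUP p\<in>?D \<times> ?D. ?a p)"
      using \<sigma> by (intro cSUP_upper ba) simp
    finally show "?c \<sigma> \<le> (SUP p\<in>?D \<times> ?D. ?a p)" .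
  qed
  ultimately show ?thesis
    unfolding amortized_divergence_def channel_divergence_def by (rule antisym)
qed

end
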